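(* Let $K=J(k,l)$ be a double twist knot, where $k,l$ are nonzero integers with $kl$ even. Let $\Phi_K(x,y)$ be the Riley polynomial of $K$ and $\sigma(K)$ the signature of $K$. Then the equation $\Phi_K(2,y)=0$ has at least $\frac12|\sigma(K)|$ real solutions $y$.
   Context: Two-bridge knots: for an odd integer $p\ge 1$ and an integer $q$ relatively prime to $p$ (which matters only modulo $p$), $\mathfrak{b}(p,q)$ is the two-bridge knot whose double branched cover is the lens space $L(p,q)$. Choosing $q$ odd in its residue class modulo $p$, the knot group has the Schubert presentation $\langle a,b\mid wa=bw\rangle$, where $a,b$ are meridians, $w=a^{\varepsilon_1}b^{\varepsilon_2}\cdots a^{\varepsilon_{p-2}}b^{\varepsilon_{p-1}}$ (letters alternate $a,b$; $w$ is empty if $p=1$) and $\varepsilon_j=(-1)^{\lfloor jq/p\rfloor}$. Double twist knots: for nonzero integers $k,l$, $J(k,l)$ is the two-bridge knot or link whose standard diagram consists of two twist boxes (one horizontal and one vertical, clasped together) with $k$ and $l$ half twists respectively, positive numbers being right-handed and negative numbers left-handed twists. It is a knot if and only if $kl$ is even. As two-bridge knots, $J(k,l)=\mathfrak{b}(p,q)$ with $p=|kl-1|$ and $q\equiv -\mathrm{sgn}(kl-1)\,l \pmod p$. In particular, for positive integers $m,n$: $J(2m,2n)=\mathfrak{b}(4mn-1,4mn-2n-1)$, $J(2m,-2n)=\mathfrak{b}(4mn+1,4mn-2n+1)$, $J(2m+1,2n)=\mathfrak{b}(4mn+2n-1,4mn-1)$, $J(2m+1,-2n)=\mathfrak{b}(4mn+2n+1,4mn+1)$.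 Riley polynomial: for $s\in\mathbb{C}\setminus\{0\}$ and $y\in\mathbb{C}$ put $$A=\begin{pmatrix}s&1\\0&s^{-1}\end{pmatrix},\qquad B=\begin{pmatrix}s&0\\2-y&s^{-1}\end{pmatrix},$$ and let $W=(W_{ij})$ be the matrix obtained from the word $w$ by substituting $a\mapsto A$, $b\mapsto B$. The matrix equation $WA=BW$ is equivalent to $\widetilde\Phi_{\mathfrak{b}(p,q)}(s,y)=0$, where $\widetilde\Phi_{\mathfrak{b}(p,q)}(s,y)=W_{11}+(s^{-1}-s)W_{12}$. This is invariant under $s\mapsto s^{-1}$, so it can be written as a polynomial in $x=s+s^{-1}$ and $y$; this polynomial is the Riley polynomial $\Phi_{\mathfrak{b}(p,q)}(x,y)$. The signature $\sigma(K)$ is the signature of the symmetrized Seifert form $V+V^{T}$ for any Seifert matrix $V$ of $K$; only its absolute value is used, so sign conventions do not matter. *)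

theory Defs
  imports Complex_Main "Jordan_Normal_Form.Char_Poly"
begin

section \<open>Link diagrams\<close>

text \<open>
  A link diagram is encoded in the manner of a PD code. Every crossing has four ends, listed
  counterclockwise as NE, NW, SW, SE; the two strands of the crossing are NE--SW and NW--SE.
  The ends of all crossings are joined in pairs by the arcs of the diagram, recorded by the
  involution \<open>glue\<close>. The flag \<open>rising c\<close> says that the strand NE--SW is the overstrand at \<open>c\<close>.
  The compass names only fix the cyclic order at each crossing; the crossings may be placed in the
  plane in any position.
\<close>

datatype compass = NE | NW | SW | SE

fun ccw :: "compass \<Rightarrow> compass" where
  "ccw NE = NW" | "ccw NW = SW" | "ccw SW = SE" | "ccw SE = NE"

fun cw :: "compass \<Rightarrow> compass" where
  "cw NE = SE" | "cw SE = SW" | "cw SW = NW" | "cw NW = NE"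

abbreviation opp :: "compass \<Rightarrow> compass" where
  "opp d \<equiv> ccw (ccw d)"

record 'c diagram =
  crossings :: "'c set"
  glue :: "'c \<times> compass \<Rightarrow> 'c \<times> compass"
  rising :: "'c \<Rightarrow> bool"

definition over_strand :: "'c diagram \<Rightarrow> 'c \<Rightarrow> compass set" where
  "over_strand D c = (if rising D c then {NE, SW} else {NW, SE})"

text \<open>
  An orientation of the link says which ends point out of their crossing.
\<close>

definition orientation :: "'c diagram \<Rightarrow> ('c \<times> compass \<Rightarrow> bool) \<Rightarrow> bool" where
  "orientation D out \<longleftrightarrow> (\<forall>c\<in>crossings D. \<forall>d.
     (out (c, opp d) \<longleftrightarrow> \<not> out (c, d)) \<and> (out (glue D (c, d)) \<longleftrightarrow> \<not> out (c, d)))"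

text \<open>
  The pair \<open>(c, d)\<close> also names the corner of \<open>c\<close> between the ends \<open>d\<close> and \<open>ccw d\<close>.
  The front corner is the one between the two outgoing ends. Looking at an oriented crossing so
  that both strands run upwards, the corners are: front = top, \<open>ccw\<close> front = left,
  \<open>opp\<close> front = bottom, \<open>cw\<close> front = right, and the end with the name of the front corner is the
  outgoing end at the top right; the crossing is positive iff that end is on the overstrand.
\<close>

definition front :: "('c \<times> compass \<Rightarrow> bool) \<Rightarrow> 'c \<Rightarrow> compass" where
  "front out c = (THE d. out (c, d) \<and> out (c, ccw d))"

definition positive_crossing :: "'c diagram \<Rightarrow> ('c \<times> compass \<Rightarrow> bool) \<Rightarrow> 'c \<Rightarrow> bool" where
  "positive_crossing D out c \<longleftrightarrow> front out c \<in> over_strand D c"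


section \<open>The Seifert form of the surface given by Seifert's algorithm\<close>

text \<open>
  Let \<open>F\<close> be the surface that Seifert's algorithm makes from an oriented diagram \<open>D\<close>: a disc for
  every Seifert circle (where circles are nested, the inner disc lies above the outer one), and a
  half-twisted band for every crossing. Let \<open>G\<close> be the planar graph made of the Seifert circles and,
  for every crossing, an edge (the core of the band) from the left strand of the smoothed crossing
  to the right one. Then \<open>G \<subseteq> F\<close>, and \<open>H\<^sub>1(F)\<close> is \<open>H\<^sub>1(G)\<close> modulo the classes of the Seifert circles.

  The faces of \<open>G\<close> are the regions of \<open>D\<close>: the crossing edge separates the front corner from the back
  corner. So 1-cycles of \<open>G\<close> are the boundaries of integral 2-chains of regions. Such a chain is
  represented by its values at the corners, which have to agree along both sides of every arc.
\<close>

definition region_chain :: "'c diagram \<Rightarrow> ('c \<times> compass \<Rightarrow> int) \<Rightarrow> bool" where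
  "region_chain D X \<longleftrightarrow> (\<forall>c\<in>crossings D. \<forall>d. case glue D (c, d) of (c', d') \<Rightarrow>
     X (c, d) = X (c', cw d') \<and> X (c, cw d) = X (c', d'))"

text \<open>
  How often the cycle bounding \<open>X\<close> runs through the band at \<open>c\<close> from left to right. These numbers
  vanish at all crossings iff the cycle is a combination of Seifert circles, so they determine
  exactly the class of the cycle in \<open>H\<^sub>1(F)\<close>.
\<close>

definition band_flow ::
  "('c \<times> compass \<Rightarrow> bool) \<Rightarrow> ('c \<times> compass \<Rightarrow> int) \<Rightarrow> 'c \<Rightarrow> int" where
  "band_flow out X c = X (c, front out c) - X (c, opp (front out c))"

text \<open>
  The linking number of \<open>x = \<partial>X\<close> with the push-off of \<open>y = \<partial>Y\<close> in the positive normal direction of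
  \<open>F\<close>, as the intersection number of \<open>X\<close> with the push-off. Isotope \<open>F\<close> so that the rims of the
  Seifert discs and the cores of the bands lie in the plane, while the discs hang down like bowls,
  with vertical walls at the rims; the positive normal of a wall points to the left of the oriented
  rim. Pushed slightly below the rims along the walls, the push-off of \<open>y\<close> meets the plane only
  near the crossings. For every passage of \<open>y\<close> from left to right through the band at \<open>c\<close>, the
  push-off comes up through the left corner and goes down through the front corner if the
  crossing is positive (left-handed band), through the back corner if it is negative.
\<close>

definition seifert_pairing ::
  "'c diagram \<Rightarrow> ('c \<times> compass \<Rightarrow> bool) \<Rightarrow> ('c \<times> compass \<Rightarrow> int) \<Rightarrow> ('c \<times> compass \<Rightarrow> int) \<Rightarrow> int"
where
  "seifert_pairing D out X Y = (\<Sum>c\<in>crossings D. band_flow out Y c *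
     (X (c, ccw (front out c)) -
      X (c, if positive_crossing D out c then front out c else opp (front out c))))"

text \<open>
  \<open>V\<close> is a Seifert matrix of \<open>D\<close>: the matrix of the Seifert form with respect to some integral basis
  of \<open>H\<^sub>1(F)\<close>, the basis being given by the chains \<open>X 0, \<dots>, X (n - 1)\<close>.
\<close>

definition seifert_matrix :: "'c diagram \<Rightarrow> ('c \<times> compass \<Rightarrow> bool) \<Rightarrow> int mat \<Rightarrow> bool" where
  "seifert_matrix D out V \<longleftrightarrow> (\<exists>n X.
     (\<forall>i<n. region_chain D (X i)) \<and>
     (\<forall>Y. region_chain D Y \<longrightarrow> (\<exists>!a. a \<in> carrier_vec n \<and>
        (\<forall>c\<in>crossings D. band_flow out Y c = (\<Sum>i<n. (a $ i) * band_flow out (X i) c)))) \<and>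
     V = mat n n (\<lambda>(i, j). seifert_pairing D out (X i) (X j)))"

definition matrix_signature :: "real mat \<Rightarrow> int" where
  "matrix_signature S =
     (\<Sum>e | poly (char_poly S) e = 0 \<and> 0 < e. int (order e (char_poly S))) -
     (\<Sum>e | poly (char_poly S) e = 0 \<and> e < 0. int (order e (char_poly S)))"


section \<open>Double twist knots\<close>

text \<open>
  The crossings \<open>Inl 0, \<dots>, Inl (\<bar>k\<bar> - 1)\<close> form the horizontal twist box, from left to right; the
  crossings \<open>Inr 0, \<dots>, Inr (\<bar>l\<bar> - 1)\<close> form the vertical twist box underneath, from top to bottom. The
  two lower ends of the horizontal box are joined to the two upper ends of the vertical one, and the
  two upper ends of the horizontal box run around the outside to the two lower ends of the vertical
  one.

  In a right-handed twist about a vertical axis the strand in front rises from left to right; about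
  a horizontal axis it falls from left to right.
\<close>

fun double_twist_glue :: "nat \<Rightarrow> nat \<Rightarrow> (nat + nat) \<times> compass \<Rightarrow> (nat + nat) \<times> compass" where
  "double_twist_glue m n (Inl i, NE) = (if i + 1 < m then (Inl (i + 1), NW) else (Inr (n - 1), SE))"
| "double_twist_glue m n (Inl i, SE) = (if i + 1 < m then (Inl (i + 1), SW) else (Inr 0, NE))"
| "double_twist_glue m n (Inl i, NW) = (if 0 < i then (Inl (i - 1), NE) else (Inr (n - 1), SW))"
| "double_twist_glue m n (Inl i, SW) = (if 0 < i then (Inl (i - 1), SE) else (Inr 0, NW))"
| "double_twist_glue m n (Inr j, SW) = (if j + 1 < n then (Inr (j + 1), NW) else (Inl 0, NW))"
| "double_twist_glue m n (Inr j, SE) = (if j + 1 < n then (Inr (j + 1), NE) else (Inl (m - 1), NE))"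
| "double_twist_glue m n (Inr j, NW) = (if 0 < j then (Inr (j - 1), SW) else (Inl 0, SW))"
| "double_twist_glue m n (Inr j, NE) = (if 0 < j then (Inr (j - 1), SE) else (Inl (m - 1), SE))"

definition double_twist :: "int \<Rightarrow> int \<Rightarrow> (nat + nat) diagram" where
  "double_twist k l = \<lparr>
     crossings = {..<nat \<bar>k\<bar>} <+> {..<nat \<bar>l\<bar>},
     glue = double_twist_glue (nat \<bar>k\<bar>) (nat \<bar>l\<bar>),
     rising = case_sum (\<lambda>_. k < 0) (\<lambda>_. 0 < l)\<rparr>"

lemma double_twist_glue_involution:
  assumes "c \<in> crossings (double_twist k l)" and "k \<noteq> 0" and "l \<noteq> 0"
  shows "glue (double_twist k l) (glue (double_twist k l) (c, d)) = (c, d)"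
    and "fst (glue (double_twist k l) (c, d)) \<in> crossings (double_twist k l)"
  using assms by (cases c; cases d; auto simp: double_twist_def)+


section \<open>Riley polynomials of two-bridge knots\<close>

definition schubert_sign :: "nat \<Rightarrow> int \<Rightarrow> nat \<Rightarrow> int" where
  "schubert_sign p q j = (if even ((int j * q) div int p) then 1 else - 1)"

text \<open>
  \<open>A s \<epsilon>\<close> and \<open>B s y \<epsilon>\<close> are the powers of the two matrices with exponent \<open>\<epsilon> \<in> {1, -1}\<close>.
\<close>

definition riley_A :: "complex \<Rightarrow> int \<Rightarrow> complex mat" where
  "riley_A s \<epsilon> = (if \<epsilon> = 1 then mat_of_rows_list 2 [[s, 1], [0, inverse s]]
     else mat_of_rows_list 2 [[inverse s, - 1], [0, s]])"

definition riley_B :: "complex \<Rightarrow> complex \<Rightarrow> int \<Rightarrow> complex mat" where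
  "riley_B s y \<epsilon> = (if \<epsilon> = 1 then mat_of_rows_list 2 [[s, 0], [2 - y, inverse s]]
     else mat_of_rows_list 2 [[inverse s, 0], [- (2 - y), s]])"

lemma riley_A_inverse: "s \<noteq> 0 \<Longrightarrow> riley_A s 1 * riley_A s (- 1) = 1\<^sub>m 2"
  and riley_B_inverse: "s \<noteq> 0 \<Longrightarrow> riley_B s y 1 * riley_B s y (- 1) = 1\<^sub>m 2"
  by (auto simp: riley_A_def riley_B_def mat_of_rows_list_def scalar_prod_def less_2_cases_iff algebra_simps
      intro!: eq_matI)

definition riley_W :: "nat \<Rightarrow> int \<Rightarrow> complex \<Rightarrow> complex \<Rightarrow> complex mat" where
  "riley_W p q s y = foldr (*)
     (map (\<lambda>j. if odd j then riley_A s (schubert_sign p q j) else riley_B s y (schubert_sign p q j))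
       [1..<p]) (1\<^sub>m 2)"

definition riley_tilde :: "nat \<Rightarrow> int \<Rightarrow> complex \<Rightarrow> complex \<Rightarrow> complex" where
  "riley_tilde p q s y = riley_W p q s y $$ (0, 0) + (inverse s - s) * riley_W p q s y $$ (0, 1)"

text \<open>
  The Schubert presentation needs an odd representative of \<open>q\<close> modulo the odd number \<open>p\<close>; any two of
  them differ by a multiple of \<open>2 p\<close> and give the same signs.
\<close>

definition odd_representative :: "nat \<Rightarrow> int \<Rightarrow> int" where
  "odd_representative p q = (if odd q then q else q + int p)"

text \<open>
  A polynomial in \<open>x\<close> and \<open>y\<close> is a polynomial in \<open>x\<close> whose coefficients are polynomials in \<open>y\<close>.
\<close>

definition poly_xy :: "complex poly poly \<Rightarrow> complex \<Rightarrow> complex \<Rightarrow> complex" where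
  "poly_xy \<Phi> x y = poly (poly \<Phi> [:x:]) y"

definition riley_poly :: "nat \<Rightarrow> int \<Rightarrow> complex poly poly" where
  "riley_poly p q = (THE \<Phi>. \<forall>s y. s \<noteq> 0 \<longrightarrow>
     poly_xy \<Phi> (s + inverse s) y = riley_tilde p (odd_representative p q) s y)"

text \<open>
  \<open>J(k,l)\<close> is the two-bridge knot \<open>b(p,q)\<close> with \<open>p = \<bar>kl - 1\<bar>\<close> and \<open>q = - sgn(kl - 1) l\<close>.
\<close>

definition double_twist_riley_poly :: "int \<Rightarrow> int \<Rightarrow> complex poly poly" where
  "double_twist_riley_poly k l = riley_poly (nat \<bar>k * l - 1\<bar>) (- sgn (k * l - 1) * l)"

end

theory Submission
  imports Defs "HOL-Analysis.Function_Topology"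
begin

text \<open>
  At \<open>x = 2\<close>, i.e. \<open>s = 1\<close>, the Riley polynomial is the entry \<open>W\<^sub>1\<^sub>1\<close>, a real function of \<open>u = 2 - y\<close>.
  If one of \<open>k\<close>, \<open>l\<close> is odd and the other is \<open>\<plusminus>2N\<close>, the Schubert signs come in blocks, and
  the block structure makes \<open>W\<close> a product of powers of one elliptic matrix whenever some trace equals
  \<open>2 cos (\<pi> i / N)\<close>, \<open>0 < i < N\<close>; there \<open>W\<close> acts as \<open>(-1)\<^sup>i\<close>. Such values of \<open>y\<close> occur in increasing
  order in \<open>(2, 10)\<close> and yield \<open>N - 1\<close> sign changes of \<open>W\<^sub>1\<^sub>1\<close>, since \<open>W\<^sub>1\<^sub>1 = 1\<close> at \<open>y = 2\<close>. At \<open>y = 10\<close> the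
  sign of \<open>W\<^sub>1\<^sub>1\<close> is \<open>(-1)\<close> to the power \<open>(p - 1) / 2\<close>, which gives one more root if \<open>k l < 0\<close>, and a
  root in the genus one case with \<open>k l > 0\<close>.

  On the other side, the surface from Seifert's algorithm has first Betti number \<open>2N\<close> (or \<open>2\<close>, if
  \<open>k\<close> and \<open>l\<close> are even), which bounds the signature. If the symmetrized form takes both signs, the
  bound improves by \<open>2\<close>; explicit chains show that it does when \<open>k l > 0\<close> (or \<open>k l < 0\<close>, if both are even).
\<close>

section \<open>Signatures of symmetric matrices\<close>

text \<open>Neither count is exact: roots are bounded from below and the signature from above. The
  bounds meet because both respond to the sign of \<open>k l\<close>. If exactly one of
  \<open>k\<close>, \<open>l\<close> is even and \<open>k l < 0\<close>, then
  \<open>(p - 1) / 2\<close> has the parity of \<open>N\<close>, so \<open>y = 10\<close> continues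
  the alternation of signs. If \<open>k l > 0\<close>, it has the parity of \<open>N - 1\<close>,
  the sign already present at the last elliptic point, and nothing is gained; that is where the form
  is indefinite. Whole blocks make up \<open>|k l|\<close> letters, but \<open>W\<close> has
  \<open>p - 1\<close> letters, which is \<open>|k l|\<close> or \<open>|k l| - 2\<close>. In the
  second case one letter is added at each end, of a kind that leaves the upper left entry alone. Two
  definitions shape the work. \<open>riley_poly\<close> is a definite description, so a polynomial
  in \<open>x\<close> and \<open>y\<close> must be exhibited; growing the palindromic word from its
  middle does this. \<open>seifert_pairing\<close> takes chains rather than homology classes, so
  sign statements are proved for every chain with prescribed band flows.\<close>

lemma quadratic_nonpos_imp_linear_zero:
  fixes a b :: real
  assumes "\<And>t. 2 * t * a + t\<^sup>2 * b \<le> 0"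
  shows "a = 0"
proof (rule ccontr)
  assume "a \<noteq> 0"
  \<comment> \<open>At \<open>t = a / c\<close> the expression equals a^2 (2 c + b) / c^2, which is
    positive once \<open>2 * c + b > 0\<close>.\<close>
  define c where "c = \<bar>b\<bar> + 1"
  have c: "c > 0" "2 * c + b > 0"
    unfolding c_def by (simp_all add: abs_if)
  have "2 * (a / c) * a + (a / c)\<^sup>2 * b = a\<^sup>2 * (2 * c + b) / c\<^sup>2"
    using c by (simp add: field_simps power2_eq_square)
  moreover have "a\<^sup>2 * (2 * c + b) / c\<^sup>2 > 0"
    using c \<open>a \<noteq> 0\<close> by simp
  ultimately show False
    using assms[of "a / c"] by linarith
qed

text \<open>A maximum point of the form on the unit sphere is an eigenvector for the maximal value.
  As the dimension \<open>n\<close> is a variable, R^n is modelled by the functions that vanish from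
  \<open>n\<close> on, in the product topology; the sphere is then a closed part of a compact
  box.\<close>

lemma symmetric_form_max_eigenvector:
  fixes s :: "nat \<Rightarrow> nat \<Rightarrow> real" and w :: "nat \<Rightarrow> real" and n :: nat
  defines "q \<equiv> \<lambda>x. \<Sum>i<n. \<Sum>j<n. s i j * x i * x j"
  assumes sym: "\<And>i j. i < n \<Longrightarrow> j < n \<Longrightarrow> s i j = s j i"
    and pos: "q w > 0"
  shows "\<exists>e x. e > 0 \<and> (\<exists>i<n. x i \<noteq> 0) \<and> (\<forall>i<n. (\<Sum>j<n. s i j * x j) = e * x i)"
proof -
  define N :: "(nat \<Rightarrow> real) \<Rightarrow> real" where "N = (\<lambda>x. \<Sum>i<n. (x i)\<^sup>2)"
  have N_eq: "N x = (\<Sum>i<n. (x i)\<^sup>2)" for x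
    by (simp add: N_def)
  define C where "C = (\<Pi>\<^sub>E i\<in>UNIV. if i < n then {-1..1::real} else {0})"
  define K where "K = {x\<in>C. N x = 1}"
  have "compactin (product_topology (\<lambda>i. euclidean) UNIV) C"
    unfolding C_def compactin_PiE by auto
  then have compC: "compact C"
    by (simp add: euclidean_product_topology)
  have coord: "continuous_on UNIV (\<lambda>x::nat \<Rightarrow> real. x i)" for i
    by (rule continuous_on_product_coordinates)
  have contN: "continuous_on UNIV N"
    unfolding N_def by (intro continuous_intros coord)
  have contq: "continuous_on UNIV q"
    unfolding q_def by (intro continuous_intros coord)
  have "K = C \<inter> N -` {1}"
    by (auto simp: K_def)
  moreover have "closed (N -` {1})"
    using contN by (intro closed_vimage) auto
  ultimately have compK: "compact K"
    using compC by (simp add: compact_Int_closed)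
  have N0: "N x = 0 \<longleftrightarrow> (\<forall>i<n. x i = 0)" for x
    unfolding N_def by (subst sum_nonneg_eq_0_iff) auto
  have normalise: "\<exists>y\<in>K. q x = q y * N x" if "N x \<noteq> 0" for x
  proof -
    have Nx: "N x > 0"
      using that sum_nonneg[of "{..<n}" "\<lambda>i. (x i)\<^sup>2"] unfolding N_def by force
    define y where "y = (\<lambda>i. if i < n then x i / sqrt (N x) else 0)"
    have "N y = (\<Sum>i<n. (x i)\<^sup>2 / N x)"
      using Nx by (subst N_eq) (auto simp: power_divide y_def intro!: sum.cong)
    also have "\<dots> = 1"
      using Nx by (simp add: sum_divide_distrib[symmetric] N_def)
    finally have Ny: "N y = 1" .
    have "(y i)\<^sup>2 \<le> 1" if "i < n" for i
      unfolding Ny[symmetric] N_def using that by (intro member_le_sum) auto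
    then have "y i \<in> {-1..1}" if "i < n" for i
      using that abs_square_le_1 by (metis abs_le_iff atLeastAtMost_iff minus_le_iff)
    then have "y \<in> K"
      using Ny by (auto simp: K_def C_def y_def)
    moreover have "q y * N x = (\<Sum>i<n. \<Sum>j<n. s i j * y i * y j * N x)"
      by (simp add: q_def sum_distrib_right)
    moreover have "\<dots> = q x"
    proof -
      have "y i * y j * N x = x i * x j" if "i < n" "j < n" for i j
        using that Nx by (simp add: y_def field_simps)
      then show ?thesis
        unfolding q_def by (intro sum.cong refl) (simp add: mult.assoc)
    qed
    ultimately show ?thesis by (intro bexI[of _ y]) simp_all
  qed
  have "N w \<noteq> 0"
    using pos N0[of w] unfolding q_def by auto
  from normalise[OF this] have "K \<noteq> {}" by auto
  from continuous_attains_sup[OF compK this continuous_on_subset[OF contq subset_UNIV]]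
  obtain x where x: "x \<in> K" "\<And>y. y \<in> K \<Longrightarrow> q y \<le> q x" by auto
  define e where "e = q x"
  have le: "q y \<le> e * N y" for y
  proof (cases "N y = 0")
    case True
    then show ?thesis using N0[of y] by (simp add: q_def)
  next
    case False
    moreover have "N y \<ge> 0"
      unfolding N_def by (intro sum_nonneg) auto
    ultimately show ?thesis
      using normalise[OF False] x(2) by (auto simp: e_def intro: mult_right_mono)
  qed
  have Nx: "N x = 1" using x by (simp add: K_def)
  have "e > 0"
  proof (rule ccontr)
    assume "\<not> e > 0"
    then have "e * N w \<le> 0"
      by (intro mult_nonpos_nonneg) (auto simp: N_def intro: sum_nonneg)
    with le[of w] pos show False by linarith
  qed
  moreover have "\<exists>i<n. x i \<noteq> 0"
    using N0[of x] Nx by auto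
  moreover have "(\<Sum>j<n. s i j * x j) = e * x i" if i: "i < n" for i
  proof -
    define g where "g = (\<Sum>j<n. s i j * x j)"
    \<comment> \<open>\<open>e * N - q\<close> is nonnegative and vanishes at \<open>x\<close>.
      Moving only coordinate \<open>i\<close> by \<open>t\<close> makes it a quadratic in
      \<open>t\<close> without constant term, so its linear coefficient is 0.\<close>
    have "2 * t * (g - e * x i) + t\<^sup>2 * (s i i - e) \<le> 0" for t
    proof -
      define d where "d = (\<lambda>j. if j = i then t else 0)"
      have single: "(\<Sum>j<n. F j (d j)) = F i t" if "\<And>j. F j 0 = 0" for F :: "nat \<Rightarrow> real \<Rightarrow> real"
      proof -
        have "(\<Sum>j<n. F j (d j)) = (\<Sum>j<n. if j = i then F i t else 0)"
          using that by (intro sum.cong) (auto simp: d_def)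
        then show ?thesis using i by simp
      qed
      define y where "y = (\<lambda>j. x j + d j)"
      have "N y = N x + 2 * (\<Sum>j<n. x j * d j) + (\<Sum>j<n. (d j)\<^sup>2)"
        unfolding N_def y_def by (simp add: power2_sum sum.distrib sum_distrib_left algebra_simps)
      also have "\<dots> = 1 + 2 * t * x i + t\<^sup>2"
        using single[of "\<lambda>j v. x j * v"] single[of "\<lambda>j v. v\<^sup>2"] Nx by simp
      finally have 1: "N y = 1 + 2 * t * x i + t\<^sup>2" .
      have swap: "(\<Sum>a<n. \<Sum>b<n. s a b * x a * d b) = (\<Sum>a<n. \<Sum>b<n. s a b * d a * x b)"
        by (subst sum.swap) (intro sum.cong refl, simp add: sym)
      have "q y = q x + (\<Sum>a<n. \<Sum>b<n. s a b * d a * x b) + (\<Sum>a<n. \<Sum>b<n. s a b * x a * d b)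
          + (\<Sum>a<n. \<Sum>b<n. s a b * d a * d b)"
        unfolding q_def y_def by (simp add: sum.distrib algebra_simps)
      also have "\<dots> = q x + 2 * (\<Sum>a<n. d a * (\<Sum>b<n. s a b * x b)) + (\<Sum>a<n. d a * (\<Sum>b<n. s a b * d b))"
        unfolding swap by (simp add: sum_distrib_left algebra_simps)
      also have "\<dots> = e + 2 * t * g + t\<^sup>2 * s i i"
        using single[of "\<lambda>a v. v * (\<Sum>b<n. s a b * x b)"] single[of "\<lambda>b v. s a b * v" for a]
          single[of "\<lambda>a v. v * (s a i * t)"]
        by (simp add: g_def e_def power2_eq_square)
      finally have "q y = e + 2 * t * g + t\<^sup>2 * s i i" .
      with le[of y] show ?thesis
        unfolding 1 by (simp add: algebra_simps)
    qed
    from quadratic_nonpos_imp_linear_zero[OF this] show ?thesis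
      by (simp add: g_def)
  qed
  ultimately show ?thesis by blast
qed

lemma symmetric_mat_positive_eigenvalue:
  fixes S :: "real mat" and w :: "nat \<Rightarrow> real"
  assumes S: "S \<in> carrier_mat n n"
    and sym: "\<And>i j. i < n \<Longrightarrow> j < n \<Longrightarrow> S $$ (i, j) = S $$ (j, i)"
    and pos: "(\<Sum>i<n. \<Sum>j<n. S $$ (i, j) * w i * w j) > 0"
  shows "\<exists>e>0. poly (char_poly S) e = 0"
proof -
  from symmetric_form_max_eigenvector[of n "\<lambda>i j. S $$ (i, j)" w, OF sym pos]
  obtain e x where e: "e > 0" and x: "\<exists>i<n. x i \<noteq> 0"
    and ev: "\<And>i. i < n \<Longrightarrow> (\<Sum>j<n. S $$ (i, j) * x j) = e * x i" by auto
  have "S *\<^sub>v vec n x = e \<cdot>\<^sub>v vec n x"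
    using S ev by (intro eq_vecI) (auto simp: scalar_prod_def atLeast0LessThan)
  moreover have "vec n x \<noteq> 0\<^sub>v n"
  proof
    assume "vec n x = 0\<^sub>v n"
    then have "x i = 0" if "i < n" for i
      using that by (metis index_vec index_zero_vec(1))
    with x show False by auto
  qed
  ultimately have "eigenvalue S e"
    using S unfolding eigenvalue_def eigenvector_def by (intro exI[of _ "vec n x"]) auto
  with eigenvalue_root_char_poly[OF S] e show ?thesis by auto
qed

lemma char_poly_uminus_root:
  fixes S :: "real mat"
  assumes "S \<in> carrier_mat n n" "poly (char_poly (- S)) e = 0"
  shows "poly (char_poly S) (- e) = 0"
proof -
  have "eigenvalue (- S) e"
    using assms eigenvalue_root_char_poly[of "- S" n e] by simp
  then obtain v where v: "v \<in> carrier_vec n" "v \<noteq> 0\<^sub>v n" "(- S) *\<^sub>v v = e \<cdot>\<^sub>v v"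
    using assms by (auto simp: eigenvalue_def eigenvector_def)
  have "S *\<^sub>v v = - ((- S) *\<^sub>v v)"
    using assms(1) v(1) by (intro eq_vecI) (auto simp: scalar_prod_def sum_negf)
  also have "\<dots> = (- e) \<cdot>\<^sub>v v"
    unfolding v(3) by (intro eq_vecI) auto
  finally have "eigenvalue S (- e)"
    using v assms(1) by (auto simp: eigenvalue_def eigenvector_def)
  then show ?thesis
    using assms(1) by (simp add: eigenvalue_root_char_poly)
qed

lemma symmetric_mat_negative_eigenvalue:
  fixes S :: "real mat" and w :: "nat \<Rightarrow> real"
  assumes S: "S \<in> carrier_mat n n"
    and sym: "\<And>i j. i < n \<Longrightarrow> j < n \<Longrightarrow> S $$ (i, j) = S $$ (j, i)"
    and neg: "(\<Sum>i<n. \<Sum>j<n. S $$ (i, j) * w i * w j) < 0"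
  shows "\<exists>e<0. poly (char_poly S) e = 0"
proof -
  have "(\<Sum>i<n. \<Sum>j<n. (- S) $$ (i, j) * w i * w j) > 0"
    using neg S by (simp add: sum_negf)
  then have "\<exists>e>0. poly (char_poly (- S)) e = 0"
    using S sym by (intro symmetric_mat_positive_eigenvalue[of _ n]) auto
  with char_poly_uminus_root[OF S] show ?thesis
    by (metis neg_less_0_iff_less)
qed

text \<open>The multiplicities P and M of positive and negative eigenvalues satisfy P + M <= n.
  Hence |P - M| <= n, and |P - M| <= n - 2 once both are at least 1.\<close>

lemma
  fixes S :: "real mat"
  assumes S: "S \<in> carrier_mat n n"
  shows matrix_signature_le: "\<bar>matrix_signature S\<bar> \<le> int n"
    and matrix_signature_indefinite_le:
      "\<lbrakk>\<exists>e>0. poly (char_poly S) e = 0; \<exists>e<0. poly (char_poly S) e = 0\<rbrakk>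
        \<Longrightarrow> \<bar>matrix_signature S\<bar> \<le> int n - 2"
proof -
  let ?p = "char_poly S"
  define P where "P = {e. poly ?p e = 0 \<and> 0 < e}"
  define M where "M = {e. poly ?p e = 0 \<and> e < 0}"
  let ?o = "\<lambda>A. \<Sum>e\<in>A. int (order e ?p)"
  have p: "degree ?p = n" "?p \<noteq> 0"
    using degree_monic_char_poly[OF S] by auto
  have fin: "finite {e. poly ?p e = 0}"
    using poly_roots_finite[OF p(2)] .
  then have finPM: "finite P" "finite M"
    by (auto simp: P_def M_def intro: finite_subset[rotated])
  have sig: "matrix_signature S = ?o P - ?o M"
    by (simp add: matrix_signature_def P_def M_def)
  have "?o P + ?o M = ?o (P \<union> M)"
    using finPM by (intro sum.union_disjoint[symmetric]) (auto simp: P_def M_def)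
  also have "\<dots> \<le> ?o {e. poly ?p e = 0}"
    using fin by (intro sum_mono2) (auto simp: P_def M_def)
  also have "\<dots> = int (\<Sum>e | poly ?p e = 0. order e ?p)"
    by simp
  also have "\<dots> \<le> int n"
    using order_sum_degree[OF p(2)] p(1) by (simp del: of_nat_sum)
  finally have sum: "?o P + ?o M \<le> int n" .
  have nonneg: "?o P \<ge> 0" "?o M \<ge> 0"
    by (auto intro: sum_nonneg)
  show "\<bar>matrix_signature S\<bar> \<le> int n"
    using sig sum nonneg by linarith
  have ge1: "?o A \<ge> 1" if "e \<in> A" "finite A" "poly ?p e = 0" for e A
  proof -
    have "1 \<le> int (order e ?p)"
      using that p(2) order_root[of ?p e] by simp
    also have "\<dots> \<le> ?o A"
      using that by (intro member_le_sum) auto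
    finally show ?thesis .
  qed
  assume "\<exists>e>0. poly ?p e = 0" "\<exists>e<0. poly ?p e = 0"
  then obtain e f where "e \<in> P" "poly ?p e = 0" "f \<in> M" "poly ?p f = 0"
    by (auto simp: P_def M_def)
  then have "?o P \<ge> 1" "?o M \<ge> 1"
    using ge1[OF _ finPM(1)] ge1[OF _ finPM(2)] by simp_all
  then show "\<bar>matrix_signature S\<bar> \<le> int n - 2"
    using sig sum by linarith
qed

section \<open>The signature of a Seifert matrix\<close>

text \<open>Fraction-free Gaussian elimination: cross-multiplying with a pivot \<open>p\<close>
  clears the coordinate \<open>c\<close> and stays integral. A relation among the remaining vectors
  is then scaled by the pivot entry, and the coefficient of \<open>p\<close> is the one that cancels
  the coordinate \<open>c\<close>.\<close>

lemma integer_relation: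
  fixes f :: "'i \<Rightarrow> 'c \<Rightarrow> int"
  assumes "finite C" "finite I" "card C < card I"
  shows "\<exists>a. (\<exists>i\<in>I. a i \<noteq> 0) \<and> (\<forall>c\<in>C. (\<Sum>i\<in>I. a i * f i c) = 0)"
  using assms
proof (induction C arbitrary: I f rule: finite_induct)
  case empty
  then have "I \<noteq> {}" by auto
  then show ?case by (intro exI[of _ "\<lambda>_. 1"]) auto
next
  case (insert c C)
  show ?case
  proof (cases "\<forall>i\<in>I. f i c = 0")
    case True
    have "card C < card I" using insert by simp
    from insert.IH[OF insert.prems(1) this, of f] show ?thesis
      using True by auto
  next
    case False
    then obtain p where p: "p \<in> I" "f p c \<noteq> 0" by auto
    define J where "J = I - {p}"
    have J: "finite J" "card C < card J" "I = insert p J" "p \<notin> J"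
      using insert p by (auto simp: J_def)
    from insert.IH[OF J(1,2), of "\<lambda>i d. f p c * f i d - f i c * f p d"]
    obtain a where a: "\<exists>i\<in>J. a i \<noteq> 0"
      "\<And>d. d \<in> C \<Longrightarrow> (\<Sum>i\<in>J. a i * (f p c * f i d - f i c * f p d)) = 0"
      by blast
    define b where "b = (\<lambda>i. if i = p then - (\<Sum>j\<in>J. a j * f j c) else a i * f p c)"
    have sum_b: "(\<Sum>i\<in>I. b i * f i d) = (\<Sum>i\<in>J. a i * (f p c * f i d - f i c * f p d))" for d
    proof -
      have "(\<Sum>i\<in>I. b i * f i d) = b p * f p d + (\<Sum>i\<in>J. b i * f i d)"
        using J by simp
      also have "(\<Sum>i\<in>J. b i * f i d) = (\<Sum>i\<in>J. a i * f p c * f i d)"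
        using J(4) by (intro sum.cong) (auto simp: b_def)
      also have "b p * f p d + (\<Sum>i\<in>J. a i * f p c * f i d)
          = (\<Sum>i\<in>J. a i * (f p c * f i d - f i c * f p d))"
        by (simp add: b_def sum_distrib_left sum_subtractf algebra_simps)
      finally show ?thesis .
    qed
    have "\<exists>i\<in>I. b i \<noteq> 0"
      using a(1) J p(2) by (force simp: b_def)
    moreover have "\<forall>d\<in>insert c C. (\<Sum>i\<in>I. b i * f i d) = 0"
      using a(2) by (auto simp: sum_b algebra_simps)
    ultimately show ?thesis by blast
  qed
qed

lemma region_chain_sum:
  assumes "\<And>i. i < (n::nat) \<Longrightarrow> region_chain D (X i)"
  shows "region_chain D (\<lambda>x. \<Sum>i<n. a i * X i x)"
  unfolding region_chain_def
proof (intro ballI allI)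
  fix c d assume c: "c \<in> crossings D"
  obtain c' d' where g: "glue D (c, d) = (c', d')" by force
  have "X i (c, d) = X i (c', cw d') \<and> X i (c, cw d) = X i (c', d')" if "i < n" for i
    using assms[OF that] c g by (auto simp: region_chain_def split: prod.splits)
  then show "case glue D (c, d) of (c', d') \<Rightarrow>
      (\<Sum>i<n. a i * X i (c, d)) = (\<Sum>i<n. a i * X i (c', cw d')) \<and>
      (\<Sum>i<n. a i * X i (c, cw d)) = (\<Sum>i<n. a i * X i (c', d'))"
    by (auto simp: g intro!: sum.cong)
qed

lemma band_flow_sum: "band_flow out (\<lambda>x. \<Sum>i<n. a i * X i x) c = (\<Sum>i<n. a i * band_flow out (X i) c)"
  by (simp add: band_flow_def sum_subtractf right_diff_distrib)

lemma seifert_pairing_sum: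
  "seifert_pairing D out (\<lambda>x. \<Sum>i<n. a i * X i x) (\<lambda>x. \<Sum>i<n. a i * X i x)
    = (\<Sum>i<n. \<Sum>j<n. a i * a j * seifert_pairing D out (X i) (X j))"
proof -
  define P :: "'a \<Rightarrow> ('a \<times> compass \<Rightarrow> int) \<Rightarrow> int" where
    "P = (\<lambda>c Y. Y (c, ccw (front out c)) -
      Y (c, if positive_crossing D out c then front out c else opp (front out c)))"
  have sp: "seifert_pairing D out Y Z = (\<Sum>c\<in>crossings D. band_flow out Z c * P c Y)" for Y Z
    by (simp add: seifert_pairing_def P_def)
  have P: "P c (\<lambda>x. \<Sum>i<n. a i * X i x) = (\<Sum>i<n. a i * P c (X i))" for c
    by (simp add: P_def sum_subtractf right_diff_distrib)
  have "seifert_pairing D out (\<lambda>x. \<Sum>i<n. a i * X i x) (\<lambda>x. \<Sum>i<n. a i * X i x)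
      = (\<Sum>c\<in>crossings D. \<Sum>i<n. \<Sum>j<n. a i * a j * (band_flow out (X j) c * P c (X i)))"
    unfolding sp P band_flow_sum sum_product
    by (rule sum.cong[OF refl], subst sum.swap) (simp add: algebra_simps)
  also have "\<dots> = (\<Sum>i<n. \<Sum>j<n. \<Sum>c\<in>crossings D. a i * a j * (band_flow out (X j) c * P c (X i)))"
    by (subst sum.swap, rule sum.cong[OF refl], subst sum.swap) simp
  finally show ?thesis
    by (simp add: sp sum_distrib_left)
qed

text \<open>\<open>C\<close> is a set of crossings whose flows control all others. More than
  \<open>card C\<close> basis chains would have an integral relation between their flows on
  \<open>C\<close>, hence everywhere, and the zero class would have two coefficient vectors.\<close>

lemma seifert_matrix_carrier:
  assumes V: "seifert_matrix D out V" and C: "finite C"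
    and det: "\<And>Y. region_chain D Y \<Longrightarrow> \<forall>c\<in>C. band_flow out Y c = 0 \<Longrightarrow>
      \<forall>c\<in>crossings D. band_flow out Y c = 0"
  shows "\<exists>n\<le>card C. V \<in> carrier_mat n n"
proof -
  from V obtain n X where X: "\<And>i. i < n \<Longrightarrow> region_chain D (X i)"
    and basis: "\<And>Y. region_chain D Y \<Longrightarrow> \<exists>!a. a \<in> carrier_vec n \<and>
        (\<forall>c\<in>crossings D. band_flow out Y c = (\<Sum>i<n. (a $ i) * band_flow out (X i) c))"
    and Vn: "V = mat n n (\<lambda>(i, j). seifert_pairing D out (X i) (X j))"
    unfolding seifert_matrix_def by blast
  have "n \<le> card C"
  proof (rule ccontr)
    assume "\<not> n \<le> card C"
    with integer_relation[OF C, of "{..<n}" "\<lambda>i. band_flow out (X i)"]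
    obtain a where a: "\<exists>i<n. a i \<noteq> 0"
      "\<And>c. c \<in> C \<Longrightarrow> (\<Sum>i<n. a i * band_flow out (X i) c) = 0"
      by auto
    define Y where "Y = (\<lambda>x. \<Sum>i<n. a i * X i x)"
    have "region_chain D Y"
      unfolding Y_def using X by (rule region_chain_sum)
    moreover have flow: "band_flow out Y c = (\<Sum>i<n. a i * band_flow out (X i) c)" for c
      unfolding Y_def by (rule band_flow_sum)
    ultimately have zero: "\<forall>c\<in>crossings D. (\<Sum>i<n. a i * band_flow out (X i) c) = 0"
      using det[of Y] a(2) by simp
    have "region_chain D (\<lambda>_. 0)"
      by (simp add: region_chain_def split: prod.splits)
    define P where "P b \<longleftrightarrow> b \<in> carrier_vec n \<and>
      (\<forall>c\<in>crossings D. band_flow out (\<lambda>_. 0) c = (\<Sum>i<n. (b $ i) * band_flow out (X i) c))" for b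
    have "\<exists>!b. P b"
      unfolding P_def using basis[OF \<open>region_chain D (\<lambda>_. 0)\<close>] .
    moreover have "P (vec n a)" "P (0\<^sub>v n)"
      using zero by (simp_all add: P_def band_flow_def)
    ultimately have "vec n a = 0\<^sub>v n"
      by blast
    then have "a i = 0" if "i < n" for i
      using that by (metis index_vec index_zero_vec(1))
    with a(1) show False by auto
  qed
  then show ?thesis using Vn by auto
qed

text \<open>The form is evaluated at the coefficients of the class of \<open>Y\<close>. The
  corresponding combination \<open>Y'\<close> of basis chains has the band flows of \<open>Y\<close>
  but may differ from \<open>Y\<close> as a chain, so the value is expressed through
  \<open>Y'\<close>.\<close>

lemma seifert_matrix_form_value:
  assumes V: "seifert_matrix D out V" "V \<in> carrier_mat n n" and Y: "region_chain D Y"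
  shows "\<exists>Y' (w :: nat \<Rightarrow> real). region_chain D Y' \<and>
    (\<forall>c\<in>crossings D. band_flow out Y' c = band_flow out Y c) \<and>
    (\<Sum>i<n. \<Sum>j<n. map_mat real_of_int (V + transpose_mat V) $$ (i, j) * w i * w j)
      = 2 * real_of_int (seifert_pairing D out Y' Y')"
proof -
  from V(1) obtain n' X where X': "\<And>i. i < n' \<Longrightarrow> region_chain D (X i)"
    and basis: "\<And>Y. region_chain D Y \<Longrightarrow> \<exists>!a. a \<in> carrier_vec n' \<and>
        (\<forall>c\<in>crossings D. band_flow out Y c = (\<Sum>i<n'. (a $ i) * band_flow out (X i) c))"
    and Vn': "V = mat n' n' (\<lambda>(i, j). seifert_pairing D out (X i) (X j))"
    unfolding seifert_matrix_def by blast
  have n': "n' = n"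
    using V(2) Vn' by auto
  note X = X'[unfolded n'] and Vn = Vn'[unfolded n']
  from ex1_implies_ex[OF basis[OF Y]] obtain a where a: "\<forall>c\<in>crossings D. band_flow out Y c = (\<Sum>i<n. (a $ i) * band_flow out (X i) c)"
    unfolding n' by auto
  define Y' where "Y' = (\<lambda>x. \<Sum>i<n. (a $ i) * X i x)"
  define w where "w = (\<lambda>i. real_of_int (a $ i))"
  let ?p = "\<lambda>i j. seifert_pairing D out (X i) (X j)"
  have Y'Y': "seifert_pairing D out Y' Y' = (\<Sum>i<n. \<Sum>j<n. a $ i * a $ j * ?p i j)"
    unfolding Y'_def by (rule seifert_pairing_sum)
  have "(\<Sum>i<n. \<Sum>j<n. map_mat real_of_int (V + transpose_mat V) $$ (i, j) * w i * w j)
      = (\<Sum>i<n. \<Sum>j<n. real_of_int (a $ i * a $ j * ?p i j) + real_of_int (a $ j * a $ i * ?p j i))"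
    by (intro sum.cong refl) (simp add: Vn w_def algebra_simps)
  also have "\<dots> = real_of_int (\<Sum>i<n. \<Sum>j<n. a $ i * a $ j * ?p i j)
      + (\<Sum>i<n. \<Sum>j<n. real_of_int (a $ j * a $ i * ?p j i))"
    by (simp add: sum.distrib)
  also have "(\<Sum>i<n. \<Sum>j<n. real_of_int (a $ j * a $ i * ?p j i))
      = real_of_int (\<Sum>i<n. \<Sum>j<n. a $ i * a $ j * ?p i j)"
    by (subst sum.swap) simp
  finally have "(\<Sum>i<n. \<Sum>j<n. map_mat real_of_int (V + transpose_mat V) $$ (i, j) * w i * w j)
      = 2 * real_of_int (seifert_pairing D out Y' Y')"
    unfolding Y'Y' by simp
  moreover have "region_chain D Y'"
    unfolding Y'_def using X by (rule region_chain_sum)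
  moreover have "\<forall>c\<in>crossings D. band_flow out Y' c = band_flow out Y c"
    using a by (simp add: Y'_def band_flow_sum)
  ultimately show ?thesis by blast
qed

lemma seifert_matrix_signature_le:
  assumes V: "seifert_matrix D out V" and C: "finite C"
    and det: "\<And>Y. region_chain D Y \<Longrightarrow> \<forall>c\<in>C. band_flow out Y c = 0 \<Longrightarrow>
      \<forall>c\<in>crossings D. band_flow out Y c = 0"
  shows "\<bar>matrix_signature (map_mat real_of_int (V + transpose_mat V))\<bar> \<le> int (card C)"
proof -
  from seifert_matrix_carrier[OF V C det] obtain n where n: "n \<le> card C" "V \<in> carrier_mat n n"
    by blast
  then have "map_mat real_of_int (V + transpose_mat V) \<in> carrier_mat n n"
    by auto
  from matrix_signature_le[OF this] n(1) show ?thesis by linarith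
qed

text \<open>A positive and a negative value of the form yield eigenvalues of both signs. The sign
  conditions range over all chains with the flows of \<open>Y\<close> or \<open>Z\<close>, since it
  is unknown which representative the basis produces.\<close>

lemma seifert_matrix_signature_indefinite_le:
  assumes V: "seifert_matrix D out V" and C: "finite C"
    and det: "\<And>Y. region_chain D Y \<Longrightarrow> \<forall>c\<in>C. band_flow out Y c = 0 \<Longrightarrow>
      \<forall>c\<in>crossings D. band_flow out Y c = 0"
    and Y: "region_chain D Y" "\<And>Y'. region_chain D Y' \<Longrightarrow>
      \<forall>c\<in>crossings D. band_flow out Y' c = band_flow out Y c \<Longrightarrow> seifert_pairing D out Y' Y' > 0"
    and Z: "region_chain D Z" "\<And>Z'. region_chain D Z' \<Longrightarrow>
      \<forall>c\<in>crossings D. band_flow out Z' c = band_flow out Z c \<Longrightarrow> seifert_pairing D out Z' Z' < 0"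
  shows "\<bar>matrix_signature (map_mat real_of_int (V + transpose_mat V))\<bar> \<le> int (card C) - 2"
proof -
  from seifert_matrix_carrier[OF V C det] obtain n where n: "n \<le> card C" "V \<in> carrier_mat n n"
    by blast
  define S where "S = map_mat real_of_int (V + transpose_mat V)"
  have S: "S \<in> carrier_mat n n"
    using n by (auto simp: S_def)
  have sym: "S $$ (i, j) = S $$ (j, i)" if "i < n" "j < n" for i j
    using that n by (simp add: S_def)
  from seifert_matrix_form_value[OF V n(2) Y(1)] obtain Y' w where
    "region_chain D Y'" "\<forall>c\<in>crossings D. band_flow out Y' c = band_flow out Y c"
    "(\<Sum>i<n. \<Sum>j<n. S $$ (i, j) * w i * w j) = 2 * real_of_int (seifert_pairing D out Y' Y')"
    unfolding S_def by blast
  with Y(2) have "(\<Sum>i<n. \<Sum>j<n. S $$ (i, j) * w i * w j) > 0" by simp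
  from symmetric_mat_positive_eigenvalue[OF S sym this]
  have pos: "\<exists>e>0. poly (char_poly S) e = 0" .
  from seifert_matrix_form_value[OF V n(2) Z(1)] obtain Z' v where
    "region_chain D Z'" "\<forall>c\<in>crossings D. band_flow out Z' c = band_flow out Z c"
    "(\<Sum>i<n. \<Sum>j<n. S $$ (i, j) * v i * v j) = 2 * real_of_int (seifert_pairing D out Z' Z')"
    unfolding S_def by blast
  with Z(2) have "(\<Sum>i<n. \<Sum>j<n. S $$ (i, j) * v i * v j) < 0" by simp
  from symmetric_mat_negative_eigenvalue[OF S sym this]
  have neg: "\<exists>e<0. poly (char_poly S) e = 0" .
  from matrix_signature_indefinite_le[OF S pos neg] n(1) show ?thesis
    unfolding S_def by linarith
qed

section \<open>Region chains and Seifert forms of double twist diagrams\<close>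

text \<open>
  A chain on the double twist diagram takes values \<open>r 0, \<dots>, r \<bar>k\<bar>\<close> on the regions met along the
  axis of the horizontal box and \<open>z 0, \<dots>, z \<bar>l\<bar>\<close> on those met along the axis of the vertical box;
  \<open>r 0\<close> and \<open>r \<bar>k\<bar>\<close> lie beside the vertical box, \<open>z \<bar>l\<bar>\<close> and \<open>z 0\<close> above and below the horizontal one.
\<close>

definition region_values ::
  "nat \<Rightarrow> nat \<Rightarrow> (nat \<Rightarrow> int) \<Rightarrow> (nat \<Rightarrow> int) \<Rightarrow> ((nat + nat) \<times> compass \<Rightarrow> int) \<Rightarrow> bool" where
  "region_values m n r z X \<longleftrightarrow>
    (\<forall>i<m. X (Inl i, NE) = z n \<and> X (Inl i, SW) = z 0 \<and> X (Inl i, NW) = r i \<and> X (Inl i, SE) = r (Suc i)) \<and>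
    (\<forall>j<n. X (Inr j, NE) = z j \<and> X (Inr j, SW) = z (Suc j) \<and> X (Inr j, NW) = r 0 \<and> X (Inr j, SE) = r m)"

lemma region_chain_double_twist_iff:
  assumes "k \<noteq> 0" "l \<noteq> 0"
  shows "region_chain (double_twist k l) X \<longleftrightarrow>
    (\<exists>r z. region_values (nat \<bar>k\<bar>) (nat \<bar>l\<bar>) r z X)"
proof -
  define m n where "m = nat \<bar>k\<bar>" and "n = nat \<bar>l\<bar>"
  have mn: "m > 0" "n > 0"
    using assms by (auto simp: m_def n_def)
  have chain: "region_chain (double_twist k l) X \<longleftrightarrow>
    (\<forall>c\<in>{..<m} <+> {..<n}. \<forall>d. case double_twist_glue m n (c, d) of (c', d') \<Rightarrow>
      X (c, d) = X (c', cw d') \<and> X (c, cw d) = X (c', d'))" (is "_ \<longleftrightarrow> ?R")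
    by (simp add: region_chain_def double_twist_def m_def n_def)
  have "?R \<longleftrightarrow> (\<exists>r z. region_values m n r z X)"
  proof
    assume R: ?R
    have glue: "X (c, d) = X (c', cw d') \<and> X (c, cw d) = X (c', d')"
      if "c \<in> {..<m} <+> {..<n}" "double_twist_glue m n (c, d) = (c', d')" for c d c' d'
      using R[rule_format, OF that(1), of d] that(2) by simp
    have mem: "Inl i \<in> {..<m} <+> {..<n} \<longleftrightarrow> i < m" "Inr j \<in> {..<m} <+> {..<n} \<longleftrightarrow> j < n" for i j
      by auto
    have h: "X (Inl i, NE) = X (Inl (Suc i), NE)" "X (Inl i, SE) = X (Inl (Suc i), NW)"
      "X (Inl i, SW) = X (Inl (Suc i), SW)" if "Suc i < m" for i
      using glue[of "Inl i" NE "Inl (Suc i)" NW] glue[of "Inl i" SE "Inl (Suc i)" SW] that by (simp_all add: mem)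
    have v: "X (Inr j, SW) = X (Inr (Suc j), NE)" "X (Inr j, NW) = X (Inr (Suc j), NW)"
      "X (Inr j, SE) = X (Inr (Suc j), SE)" if "Suc j < n" for j
      using glue[of "Inr j" SW "Inr (Suc j)" NW] glue[of "Inr j" SE "Inr (Suc j)" NE] that by (simp_all add: mem)
    have corners: "X (Inl (m - 1), NE) = X (Inr (n - 1), SW)" "X (Inl (m - 1), SE) = X (Inr (n - 1), SE)"
      "X (Inl 0, SW) = X (Inr 0, NE)" "X (Inl 0, NW) = X (Inr 0, NW)"
      using glue[of "Inl (m - 1)" NE "Inr (n - 1)" SE] glue[of "Inl 0" SW "Inr 0" NW] mn by (simp_all add: mem)
    \<comment> \<open>A box with \<open>m\<close> crossings meets \<open>m + 1\<close> regions along
      its axis; the last value is read off the far side of the last crossing. The same holds for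
      \<open>z\<close>.\<close>
    define r where "r = (\<lambda>i. if i < m then X (Inl i, NW) else X (Inl (m - 1), SE))"
    define z where "z = (\<lambda>j. if j < n then X (Inr j, NE) else X (Inr (n - 1), SW))"
    have hc: "X (Inl i, NE) = X (Inl 0, NE) \<and> X (Inl i, SW) = X (Inl 0, SW)" if "i < m" for i
      using that by (induction i) (use h in auto)
    have vc: "X (Inr j, NW) = X (Inr 0, NW) \<and> X (Inr j, SE) = X (Inr 0, SE)" if "j < n" for j
      using that by (induction j) (use v in auto)
    have "X (Inl i, NE) = z n \<and> X (Inl i, SW) = z 0" if "i < m" for i
      using hc[OF that] hc[of "m - 1"] that mn corners by (simp add: z_def)
    moreover have "X (Inl i, NW) = r i \<and> X (Inl i, SE) = r (Suc i)" if "i < m" for i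
      using that h(2)[of i] by (cases "Suc i < m") (auto simp: r_def less_Suc_eq dest: Suc_lessI)
    moreover have "X (Inr j, NW) = r 0 \<and> X (Inr j, SE) = r m" if "j < n" for j
      using vc[OF that] vc[of "n - 1"] that mn corners by (simp add: r_def)
    moreover have "X (Inr j, NE) = z j \<and> X (Inr j, SW) = z (Suc j)" if "j < n" for j
      using that v(1)[of j] by (cases "Suc j < n") (auto simp: z_def less_Suc_eq dest: Suc_lessI)
    ultimately have "region_values m n r z X"
      by (simp add: region_values_def)
    then show "\<exists>r z. region_values m n r z X"
      by blast
  next
    assume "\<exists>r z. region_values m n r z X"
    then obtain r z where
      *: "\<And>i. i < m \<Longrightarrow> X (Inl i, NE) = z n" "\<And>i. i < m \<Longrightarrow> X (Inl i, SW) = z 0"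
        "\<And>i. i < m \<Longrightarrow> X (Inl i, NW) = r i" "\<And>i. i < m \<Longrightarrow> X (Inl i, SE) = r (Suc i)"
        "\<And>j. j < n \<Longrightarrow> X (Inr j, NE) = z j" "\<And>j. j < n \<Longrightarrow> X (Inr j, SW) = z (Suc j)"
        "\<And>j. j < n \<Longrightarrow> X (Inr j, NW) = r 0" "\<And>j. j < n \<Longrightarrow> X (Inr j, SE) = r m"
      unfolding region_values_def by blast
    show ?R
    proof (intro ballI allI)
      fix c d assume c: "c \<in> {..<m} <+> {..<n}"
      show "case double_twist_glue m n (c, d) of (c', d') \<Rightarrow>
          X (c, d) = X (c', cw d') \<and> X (c, cw d) = X (c', d')"
      proof (cases c)
        case (Inl i)
        with c have i: "i < m" by auto
        then consider "Suc i < m" | "m = Suc i" by linarith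
        then show ?thesis
          using i mn by cases (cases d; cases i; simp add: Inl *)+
      next
        case (Inr j)
        with c have j: "j < n" by auto
        then consider "Suc j < n" | "n = Suc j" by linarith
        then show ?thesis
          using j mn by cases (cases d; cases j; simp add: Inr *)+
      qed
    qed
  qed
  then show ?thesis
    using chain by (simp add: m_def n_def)
qed

lemma front_eqI:
  assumes "orientation D out" "c \<in> crossings D" "out (c, d)" "out (c, ccw d)"
  shows "front out c = d"
  unfolding front_def
proof (rule the_equality)
  have opp: "out (c, opp d) \<longleftrightarrow> \<not> out (c, d)" for d
    using assms by (auto simp: orientation_def)
  show "out (c, d) \<and> out (c, ccw d)" using assms by simp
  fix e assume "out (c, e) \<and> out (c, ccw e)"
  then show "e = d"
    using assms(3,4) opp[of d] opp[of "ccw d"] by (cases d; cases e) auto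
qed

section \<open>Orientations of double twist diagrams\<close>

locale oriented_double_twist =
  fixes k l :: int and out :: "(nat + nat) \<times> compass \<Rightarrow> bool" and m n :: nat
  assumes nz: "k \<noteq> 0" "l \<noteq> 0"
    and orient: "orientation (double_twist k l) out"
  defines "m \<equiv> nat \<bar>k\<bar>" and "n \<equiv> nat \<bar>l\<bar>"
begin

abbreviation D where "D \<equiv> double_twist k l"

lemma mn: "m > 0" "n > 0"
  using nz by (auto simp: m_def n_def)

lemma crossings_D: "crossings D = {..<m} <+> {..<n}"
  and glue_D: "glue D = double_twist_glue m n"
  by (auto simp: double_twist_def m_def n_def)

lemma Inl_crossing: "i < m \<Longrightarrow> Inl i \<in> crossings D"
  and Inr_crossing: "j < n \<Longrightarrow> Inr j \<in> crossings D"
  by (auto simp: crossings_D)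

lemma out_opp: "c \<in> crossings D \<Longrightarrow> out (c, opp d) \<longleftrightarrow> \<not> out (c, d)"
  and out_glue: "c \<in> crossings D \<Longrightarrow> out (double_twist_glue m n (c, d)) \<longleftrightarrow> \<not> out (c, d)"
  using orient by (auto simp: orientation_def glue_D)

lemma out_Inl:
  assumes "i < m"
  shows "out (Inl i, NW) \<longleftrightarrow> \<not> out (Inl i, SE)" "out (Inl i, SW) \<longleftrightarrow> \<not> out (Inl i, NE)"
  using out_opp[OF Inl_crossing[OF assms], of SE] out_opp[OF Inl_crossing[OF assms], of NE] by auto

lemma out_Inr:
  assumes "j < n"
  shows "out (Inr j, NW) \<longleftrightarrow> \<not> out (Inr j, SE)" "out (Inr j, NE) \<longleftrightarrow> \<not> out (Inr j, SW)"
  using out_opp[OF Inr_crossing[OF assms], of SE] out_opp[OF Inr_crossing[OF assms], of SW] by auto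

text \<open>A half twist exchanges the two strands, so the directions at the two right-hand ends
  swap from each crossing to the next.\<close>

lemma out_Inl_alternating:
  assumes "i < m"
  shows "(out (Inl i, NE) \<longleftrightarrow> (if even i then out (Inl 0, NE) else out (Inl 0, SE))) \<and>
         (out (Inl i, SE) \<longleftrightarrow> (if even i then out (Inl 0, SE) else out (Inl 0, NE)))"
  using assms
proof (induction i)
  case (Suc i)
  then show ?case
    using out_glue[OF Inl_crossing[of i], of NE] out_glue[OF Inl_crossing[of i], of SE]
      out_Inl[of "Suc i"] by auto
qed simp

lemma out_Inr_alternating:
  assumes "j < n"
  shows "(out (Inr j, SW) \<longleftrightarrow> (if even j then out (Inr 0, SW) else out (Inr 0, SE))) \<and>
         (out (Inr j, SE) \<longleftrightarrow> (if even j then out (Inr 0, SE) else out (Inr 0, SW)))"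
  using assms
proof (induction j)
  case (Suc j)
  then show ?case
    using out_glue[OF Inr_crossing[of j], of SW] out_glue[OF Inr_crossing[of j], of SE]
      out_Inr[of "Suc j"] by auto
qed simp

lemma out_corners:
  "out (Inl 0, SE) \<longleftrightarrow> out (Inr (n - 1), SW)"
  "out (Inl 0, NE) \<longleftrightarrow> \<not> out (Inr 0, SE)"
  "out (Inl (m - 1), NE) \<longleftrightarrow> \<not> out (Inr (n - 1), SE)"
  "out (Inl (m - 1), SE) \<longleftrightarrow> out (Inr 0, SW)"
  using out_glue[OF Inl_crossing[of 0], of NW] out_glue[OF Inl_crossing[of 0], of SW]
    out_glue[OF Inl_crossing[of "m - 1"], of NE] out_glue[OF Inl_crossing[of "m - 1"], of SE]
    mn out_Inl[of 0] out_Inr[of 0] by auto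

text \<open>
  The flag \<open>u\<close> encodes the direction of the strands. In an antiparallel box the front corner alternates
  between the two sides of the box; in a parallel box it always points along the axis.
\<close>

definition h_antiparallel where
  "h_antiparallel u \<longleftrightarrow> (\<forall>i<m. front out (Inl i) = (if even i = u then NE else SW))"
definition h_parallel where
  "h_parallel u \<longleftrightarrow> (\<forall>i<m. front out (Inl i) = (if u then SE else NW))"
definition v_antiparallel where
  "v_antiparallel u \<longleftrightarrow> (\<forall>j<n. front out (Inr j) = (if even j = u then SE else NW))"
definition v_parallel where
  "v_parallel u \<longleftrightarrow> (\<forall>j<n. front out (Inr j) = (if u then SW else NE))"

lemma front_Inl:
  assumes "i < m"
  shows "front out (Inl i) = (if out (Inl i, NE) then if out (Inl i, SE) then SE else NE
     else if out (Inl i, SE) then SW else NW)"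
  using out_Inl[OF assms]
  by (intro front_eqI[OF orient Inl_crossing[OF assms]]) auto

lemma front_Inr:
  assumes "j < n"
  shows "front out (Inr j) = (if out (Inr j, SW) then if out (Inr j, SE) then SW else NW
     else if out (Inr j, SE) then SE else NE)"
  using out_Inr[OF assms]
  by (intro front_eqI[OF orient Inr_crossing[OF assms]]) auto

lemma h_cases:
  "out (Inl 0, NE) \<noteq> out (Inl 0, SE) \<Longrightarrow> h_antiparallel (out (Inl 0, NE))"
  "out (Inl 0, NE) = out (Inl 0, SE) \<Longrightarrow> h_parallel (out (Inl 0, NE))"
proof -
  note alt = front_Inl out_Inl_alternating
  show "h_antiparallel (out (Inl 0, NE))" if "out (Inl 0, NE) \<noteq> out (Inl 0, SE)"
    using that unfolding h_antiparallel_def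
    by (cases "out (Inl 0, NE)"; cases "out (Inl 0, SE)") (auto simp: alt)
  show "h_parallel (out (Inl 0, NE))" if "out (Inl 0, NE) = out (Inl 0, SE)"
    using that unfolding h_parallel_def
    by (cases "out (Inl 0, NE)"; cases "out (Inl 0, SE)") (auto simp: alt)
qed

lemma v_cases:
  "out (Inr 0, SW) \<noteq> out (Inr 0, SE) \<Longrightarrow> v_antiparallel (out (Inr 0, SE))"
  "out (Inr 0, SW) = out (Inr 0, SE) \<Longrightarrow> v_parallel (out (Inr 0, SW))"
proof -
  note alt = front_Inr out_Inr_alternating
  show "v_antiparallel (out (Inr 0, SE))" if "out (Inr 0, SW) \<noteq> out (Inr 0, SE)"
    using that unfolding v_antiparallel_def
    by (cases "out (Inr 0, SW)"; cases "out (Inr 0, SE)") (auto simp: alt)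
  show "v_parallel (out (Inr 0, SW))" if "out (Inr 0, SW) = out (Inr 0, SE)"
    using that unfolding v_parallel_def
    by (cases "out (Inr 0, SW)"; cases "out (Inr 0, SE)") (auto simp: alt)
qed

lemma parity:
  "even m \<longleftrightarrow> even k" "even n \<longleftrightarrow> even l"
  by (auto simp: m_def n_def even_nat_iff)

lemma both_even:
  assumes "even k" "even l"
  shows "\<exists>u v. h_antiparallel u \<and> v_antiparallel v"
proof -
  have "odd (m - 1)" "odd (n - 1)"
    using assms mn parity by auto
  then have "out (Inl (m - 1), NE) = out (Inl 0, SE)" "out (Inl (m - 1), SE) = out (Inl 0, NE)"
    "out (Inr (n - 1), SW) = out (Inr 0, SE)" "out (Inr (n - 1), SE) = out (Inr 0, SW)"
    using out_Inl_alternating[of "m - 1"] out_Inr_alternating[of "n - 1"] mn by simp_all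
  with out_corners have "out (Inl 0, NE) \<noteq> out (Inl 0, SE)" "out (Inr 0, SW) \<noteq> out (Inr 0, SE)"
    by argo+
  then show ?thesis using h_cases(1) v_cases(1) by blast
qed

text \<open>The connecting arcs tie the directions in the two boxes together, hence the common flag
  \<open>u\<close>. It is what makes the boundary terms of \<open>h_antiparallel_sum\<close> and
  \<open>v_parallel_sum\<close> cancel in the total form.\<close>

lemma odd_even:
  assumes "odd k" "even l"
  shows "\<exists>u. h_antiparallel (\<not> u) \<and> v_parallel u"
proof -
  have "even (m - 1)" "odd (n - 1)"
    using assms mn parity by auto
  then have "out (Inl (m - 1), NE) = out (Inl 0, NE)" "out (Inl (m - 1), SE) = out (Inl 0, SE)"
    "out (Inr (n - 1), SW) = out (Inr 0, SE)" "out (Inr (n - 1), SE) = out (Inr 0, SW)"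
    using out_Inl_alternating[of "m - 1"] out_Inr_alternating[of "n - 1"] mn by simp_all
  with out_corners have "out (Inl 0, NE) \<noteq> out (Inl 0, SE)" "out (Inr 0, SW) = out (Inr 0, SE)"
    "out (Inr 0, SW) \<longleftrightarrow> \<not> out (Inl 0, NE)"
    by argo+
  then show ?thesis
    using h_cases(1) v_cases(2) by (intro exI[of _ "out (Inr 0, SW)"]) simp
qed

lemma even_odd:
  assumes "even k" "odd l"
  shows "\<exists>u. h_parallel u \<and> v_antiparallel (\<not> u)"
proof -
  have "odd (m - 1)" "even (n - 1)"
    using assms mn parity by auto
  then have "out (Inl (m - 1), NE) = out (Inl 0, SE)" "out (Inl (m - 1), SE) = out (Inl 0, NE)"
    "out (Inr (n - 1), SW) = out (Inr 0, SW)" "out (Inr (n - 1), SE) = out (Inr 0, SE)"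
    using out_Inl_alternating[of "m - 1"] out_Inr_alternating[of "n - 1"] mn by simp_all
  with out_corners have "out (Inl 0, NE) = out (Inl 0, SE)" "out (Inr 0, SW) \<noteq> out (Inr 0, SE)"
    "out (Inr 0, SE) \<longleftrightarrow> \<not> out (Inl 0, NE)"
    by argo+
  then show ?thesis
    using h_cases(2) v_cases(1) by (intro exI[of _ "out (Inl 0, NE)"]) simp
qed

end

text \<open>Each inner value \<open>r i\<close> occurs twice with opposite signs or not at all. For
  the rest, \<open>2 * (P - Q) * P\<close> is P^2 - Q^2 + (P - Q)^2 and
  \<open>2 * (P - Q) * Q\<close> is P^2 - Q^2 - (P - Q)^2: the differences of squares cancel between
  neighbours and every crossing contributes one square, always with the same sign.\<close>

lemma antiparallel_box_sum:
  fixes r :: "nat \<Rightarrow> int" and P Q :: int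
  shows "2 * (\<Sum>i<N. if even i = u then (P - Q) * (r i - (if s then P else Q))
      else (Q - P) * (r (Suc i) - (if s then Q else P)))
    = (if even N then (if u then 2 * (P - Q) * (r 0 - r N) else 0)
       else if u then 2 * (P - Q) * r 0 - (P\<^sup>2 - Q\<^sup>2) else (P\<^sup>2 - Q\<^sup>2) - 2 * (P - Q) * r N)
      - (if s then 1 else - 1) * int N * (P - Q)\<^sup>2"
proof (induction N)
  case (Suc N)
  then show ?case
    by (cases u; cases s; cases "even N") (simp_all add: algebra_simps power2_eq_square)
qed simp

text \<open>Since 2 (z' - z) z' = z'^2 - z^2 + (z' - z)^2 and 2 (z' - z) z = z'^2 - z^2 - (z' -
  z)^2, everything except the squared differences telescopes.\<close>

lemma parallel_box_sum:
  fixes z :: "nat \<Rightarrow> int" and a b :: int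
  shows "2 * (\<Sum>j<N. if u then (z (Suc j) - z j) * (a - (if s then z (Suc j) else z j))
      else (z j - z (Suc j)) * (b - (if s then z j else z (Suc j))))
    = (if u then 2 * a * (z N - z 0) - ((z N)\<^sup>2 - (z 0)\<^sup>2) else ((z N)\<^sup>2 - (z 0)\<^sup>2) - 2 * b * (z N - z 0))
      - (if s then 1 else - 1) * (\<Sum>j<N. (z (Suc j) - z j)\<^sup>2)"
proof (induction N)
  case (Suc N)
  then show ?case
    by (cases u; cases s) (simp_all add: algebra_simps power2_eq_square)
qed simp

text \<open>For \<open>a\<close> and \<open>b\<close> of equal sign the two terms of the form
  compete. The bump \<open>f\<close> has total difference 0 and leaves only the sum of squares; the
  two unit steps of \<open>g\<close> give \<open>4 * a - 2 * sgn b\<close>, which has the sign of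
  \<open>a\<close>.\<close>

lemma difference_form_signature_le:
  fixes Y :: "(nat \<Rightarrow> int) \<Rightarrow> 'c \<times> compass \<Rightarrow> int" and a b :: int
  assumes V: "seifert_matrix D out V" and C: "finite C"
    and det: "\<And>Y. region_chain D Y \<Longrightarrow> \<forall>c\<in>C. band_flow out Y c = 0 \<Longrightarrow>
      \<forall>c\<in>crossings D. band_flow out Y c = 0"
    and chain: "\<And>f. region_chain D (Y f)"
    and form: "\<And>f Y'. region_chain D Y' \<Longrightarrow>
      \<forall>c\<in>crossings D. band_flow out Y' c = band_flow out (Y f) c \<Longrightarrow>
      2 * seifert_pairing D out Y' Y' = a * (f N - f 0)\<^sup>2 - sgn b * (\<Sum>i<N. (f (Suc i) - f i)\<^sup>2)"
    and ab: "0 < a * b" and N: "N \<ge> 2"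
  shows "\<bar>matrix_signature (map_mat real_of_int (V + transpose_mat V))\<bar> \<le> int (card C) - 2"
proof -
  obtain M where M: "N = Suc (Suc M)"
    using N by (metis add_2_eq_Suc le_Suc_ex)
  define f where "f = (\<lambda>i::nat. if i = 1 then 1 else 0 :: int)"
  define g where "g = (\<lambda>i::nat. if i = 0 then 0 else if i = 1 then 1 else 2 :: int)"
  have fg: "f N - f 0 = 0" "g N - g 0 = 2" "(\<Sum>i<N. (f (Suc i) - f i)\<^sup>2) = 2"
    "(\<Sum>i<N. (g (Suc i) - g i)\<^sup>2) = 2"
    unfolding M by (simp_all add: f_def g_def sum.lessThan_Suc_shift del: sum.lessThan_Suc)
  have F: "2 * seifert_pairing D out Y' Y' = - 2 * sgn b"
    if "region_chain D Y'" "\<forall>c\<in>crossings D. band_flow out Y' c = band_flow out (Y f) c" for Y'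
    using form[OF that] by (simp add: fg)
  have G: "2 * seifert_pairing D out Y' Y' = 4 * a - 2 * sgn b"
    if "region_chain D Y'" "\<forall>c\<in>crossings D. band_flow out Y' c = band_flow out (Y g) c" for Y'
    using form[OF that] by (simp add: fg)
  show ?thesis
  proof (cases "0 < b")
    case True
    then have "a > 0" using ab by (simp add: zero_less_mult_iff)
    show ?thesis
    proof (rule seifert_matrix_signature_indefinite_le[OF V C det chain[of g] _ chain[of f]])
      show "0 < seifert_pairing D out Y' Y'"
        if "region_chain D Y'" "\<forall>c\<in>crossings D. band_flow out Y' c = band_flow out (Y g) c" for Y'
        using G[OF that] True \<open>a > 0\<close> by simp
      show "seifert_pairing D out Y' Y' < 0"
        if "region_chain D Y'" "\<forall>c\<in>crossings D. band_flow out Y' c = band_flow out (Y f) c" for Y'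
        using F[OF that] True by simp
    qed
  next
    case False
    then have "a < 0" "b < 0" using ab by (auto simp: zero_less_mult_iff)
    show ?thesis
    proof (rule seifert_matrix_signature_indefinite_le[OF V C det chain[of f] _ chain[of g]])
      show "seifert_pairing D out Y' Y' < 0"
        if "region_chain D Y'" "\<forall>c\<in>crossings D. band_flow out Y' c = band_flow out (Y g) c" for Y'
        using G[OF that] \<open>a < 0\<close> \<open>b < 0\<close> by simp
      show "0 < seifert_pairing D out Y' Y'"
        if "region_chain D Y'" "\<forall>c\<in>crossings D. band_flow out Y' c = band_flow out (Y f) c" for Y'
        using F[OF that] \<open>b < 0\<close> by simp
    qed
  qed
qed

section \<open>The Seifert form as a sum over the two boxes\<close>

context oriented_double_twist
begin

lemma rising_D: "rising D (Inl i) \<longleftrightarrow> k < 0" "rising D (Inr j) \<longleftrightarrow> 0 < l"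
  by (simp_all add: double_twist_def)

definition corner_difference where
  "corner_difference X c = X (c, ccw (front out c)) -
      X (c, if positive_crossing D out c then front out c else opp (front out c))"

lemma seifert_pairing_boxes:
  "seifert_pairing D out X Y =
    (\<Sum>i<m. band_flow out Y (Inl i) * corner_difference X (Inl i)) +
    (\<Sum>j<n. band_flow out Y (Inr j) * corner_difference X (Inr j))"
  by (simp add: seifert_pairing_def corner_difference_def crossings_D sum.Plus)

lemma h_antiparallel_crossing:
  assumes "h_antiparallel u" "region_values m n r z X" "i < m"
  shows "band_flow out X (Inl i) = (if even i = u then z n - z 0 else z 0 - z n)"
    and "corner_difference X (Inl i) = (if even i = u then r i - (if k < 0 then z n else z 0)
      else r (Suc i) - (if k < 0 then z 0 else z n))"
  using assms unfolding h_antiparallel_def region_values_def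
  by (simp_all add: band_flow_def corner_difference_def positive_crossing_def over_strand_def rising_D)

lemma h_parallel_crossing:
  assumes "h_parallel u" "region_values m n r z X" "i < m"
  shows "band_flow out X (Inl i) = (if u then r (Suc i) - r i else r i - r (Suc i))"
    and "corner_difference X (Inl i) = (if u then z n - (if 0 < k then r (Suc i) else r i)
      else z 0 - (if 0 < k then r i else r (Suc i)))"
  using assms nz unfolding h_parallel_def region_values_def
  by (auto simp add: band_flow_def corner_difference_def positive_crossing_def over_strand_def rising_D)

lemma v_antiparallel_crossing:
  assumes "v_antiparallel u" "region_values m n r z X" "j < n"
  shows "band_flow out X (Inr j) = (if even j = u then r m - r 0 else r 0 - r m)"
    and "corner_difference X (Inr j) = (if even j = u then z j - (if l < 0 then r m else r 0)
      else z (Suc j) - (if l < 0 then r 0 else r m))"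
  using assms nz unfolding v_antiparallel_def region_values_def
  by (auto simp add: band_flow_def corner_difference_def positive_crossing_def over_strand_def rising_D)

lemma v_parallel_crossing:
  assumes "v_parallel u" "region_values m n r z X" "j < n"
  shows "band_flow out X (Inr j) = (if u then z (Suc j) - z j else z j - z (Suc j))"
    and "corner_difference X (Inr j) = (if u then r m - (if 0 < l then z (Suc j) else z j)
      else r 0 - (if 0 < l then z j else z (Suc j)))"
  using assms unfolding v_parallel_def region_values_def
  by (simp_all add: band_flow_def corner_difference_def positive_crossing_def over_strand_def rising_D)

lemma h_antiparallel_sum:
  assumes "h_antiparallel u" "region_values m n r z X"
  shows "2 * (\<Sum>i<m. band_flow out X (Inl i) * corner_difference X (Inl i))
    = (if even m then (if u then 2 * (z n - z 0) * (r 0 - r m) else 0)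
       else if u then 2 * (z n - z 0) * r 0 - ((z n)\<^sup>2 - (z 0)\<^sup>2)
       else ((z n)\<^sup>2 - (z 0)\<^sup>2) - 2 * (z n - z 0) * r m) + k * (z n - z 0)\<^sup>2"
proof -
  have "(\<Sum>i<m. band_flow out X (Inl i) * corner_difference X (Inl i))
      = (\<Sum>i<m. if even i = u then (z n - z 0) * (r i - (if k < 0 then z n else z 0))
          else (z 0 - z n) * (r (Suc i) - (if k < 0 then z 0 else z n)))"
    by (intro sum.cong) (simp_all add: h_antiparallel_crossing[OF assms])
  moreover have "(if k < 0 then 1 else - 1) * int m = - k"
    by (simp add: m_def)
  ultimately show ?thesis
    by (simp only: antiparallel_box_sum)
qed

lemma v_antiparallel_sum:
  assumes "v_antiparallel u" "region_values m n r z X"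
  shows "2 * (\<Sum>j<n. band_flow out X (Inr j) * corner_difference X (Inr j))
    = (if even n then (if u then 2 * (r m - r 0) * (z 0 - z n) else 0)
       else if u then 2 * (r m - r 0) * z 0 - ((r m)\<^sup>2 - (r 0)\<^sup>2)
       else ((r m)\<^sup>2 - (r 0)\<^sup>2) - 2 * (r m - r 0) * z n) + l * (r m - r 0)\<^sup>2"
proof -
  have "(\<Sum>j<n. band_flow out X (Inr j) * corner_difference X (Inr j))
      = (\<Sum>j<n. if even j = u then (r m - r 0) * (z j - (if l < 0 then r m else r 0))
          else (r 0 - r m) * (z (Suc j) - (if l < 0 then r 0 else r m)))"
    by (intro sum.cong) (simp_all add: v_antiparallel_crossing[OF assms])
  moreover have "(if l < 0 then 1 else - 1) * int n = - l"
    by (simp add: n_def)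
  ultimately show ?thesis
    by (simp only: antiparallel_box_sum)
qed

lemma h_parallel_sum:
  assumes "h_parallel u" "region_values m n r z X"
  shows "2 * (\<Sum>i<m. band_flow out X (Inl i) * corner_difference X (Inl i))
    = (if u then 2 * z n * (r m - r 0) - ((r m)\<^sup>2 - (r 0)\<^sup>2) else ((r m)\<^sup>2 - (r 0)\<^sup>2) - 2 * z 0 * (r m - r 0))
      - sgn k * (\<Sum>i<m. (r (Suc i) - r i)\<^sup>2)"
proof -
  have "(\<Sum>i<m. band_flow out X (Inl i) * corner_difference X (Inl i))
      = (\<Sum>i<m. if u then (r (Suc i) - r i) * (z n - (if 0 < k then r (Suc i) else r i))
          else (r i - r (Suc i)) * (z 0 - (if 0 < k then r i else r (Suc i))))"
    by (intro sum.cong) (simp_all add: h_parallel_crossing[OF assms])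
  moreover have "sgn k = (if 0 < k then 1 else - 1)"
    using nz by simp
  ultimately show ?thesis
    by (simp only: parallel_box_sum)
qed

lemma v_parallel_sum:
  assumes "v_parallel u" "region_values m n r z X"
  shows "2 * (\<Sum>j<n. band_flow out X (Inr j) * corner_difference X (Inr j))
    = (if u then 2 * r m * (z n - z 0) - ((z n)\<^sup>2 - (z 0)\<^sup>2) else ((z n)\<^sup>2 - (z 0)\<^sup>2) - 2 * r 0 * (z n - z 0))
      - sgn l * (\<Sum>j<n. (z (Suc j) - z j)\<^sup>2)"
proof -
  have "(\<Sum>j<n. band_flow out X (Inr j) * corner_difference X (Inr j))
      = (\<Sum>j<n. if u then (z (Suc j) - z j) * (r m - (if 0 < l then z (Suc j) else z j))
          else (z j - z (Suc j)) * (r 0 - (if 0 < l then z j else z (Suc j))))"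
    by (intro sum.cong) (simp_all add: v_parallel_crossing[OF assms])
  moreover have "sgn l = (if 0 < l then 1 else - 1)"
    using nz by simp
  ultimately show ?thesis
    by (simp only: parallel_box_sum)
qed

lemma region_chain_iff: "region_chain D X \<longleftrightarrow> (\<exists>r z. region_values m n r z X)"
  using region_chain_double_twist_iff[OF nz] by (simp add: m_def n_def)

definition chain :: "(nat \<Rightarrow> int) \<Rightarrow> (nat \<Rightarrow> int) \<Rightarrow> (nat + nat) \<times> compass \<Rightarrow> int" where
  "chain r z = (\<lambda>(c, d). case c of
     Inl i \<Rightarrow> (case d of NE \<Rightarrow> z n | SW \<Rightarrow> z 0 | NW \<Rightarrow> r i | SE \<Rightarrow> r (Suc i))
   | Inr j \<Rightarrow> (case d of NE \<Rightarrow> z j | SW \<Rightarrow> z (Suc j) | NW \<Rightarrow> r 0 | SE \<Rightarrow> r m))"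

lemma region_values_chain: "region_values m n r z (chain r z)"
  by (simp add: region_values_def chain_def)

lemma region_chain_chain: "region_chain D (chain r z)"
  using region_values_chain region_chain_iff by blast

text \<open>Both boxes are antiparallel, so up to sign a single flow runs through each of them and
  two crossings control everything. The form takes the values \<open>k\<close> and \<open>l\<close>
  on chains with flow through one box only, which also kills the mixed term; for
  \<open>k * l < 0\<close> these values differ in sign.\<close>

lemma signature_both_even:
  assumes "even k" "even l" and V: "seifert_matrix D out V"
  shows "\<bar>matrix_signature (map_mat real_of_int (V + transpose_mat V))\<bar> \<le> 2"
    and "k * l < 0 \<Longrightarrow> \<bar>matrix_signature (map_mat real_of_int (V + transpose_mat V))\<bar> \<le> 0"
proof -
  from both_even[OF assms(1,2)] obtain u v where uv: "h_antiparallel u" "v_antiparallel v"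
    by blast
  define C where "C = {Inl 0, Inr 0 :: nat + nat}"
  have C: "finite C" "card C = 2"
    by (simp_all add: C_def)
  have det: "\<forall>c\<in>crossings D. band_flow out Y c = 0"
    if "region_chain D Y" "\<forall>c\<in>C. band_flow out Y c = 0" for Y
  proof -
    from that(1) obtain r z where rz: "region_values m n r z Y"
      by (auto simp: region_chain_iff)
    note fl = h_antiparallel_crossing(1)[OF uv(1) rz] v_antiparallel_crossing(1)[OF uv(2) rz]
    have "z n = z 0" "r m = r 0"
      using that(2) fl(1)[of 0] fl(2)[of 0] mn by (auto simp: C_def split: if_splits)
    then show ?thesis
      using fl by (auto simp: crossings_D)
  qed
  show "\<bar>matrix_signature (map_mat real_of_int (V + transpose_mat V))\<bar> \<le> 2"
    using seifert_matrix_signature_le[OF V C(1) det] C(2) by simp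
  have form: "2 * seifert_pairing D out Y' Y' = k * (z n - z 0)\<^sup>2 + l * (r m - r 0)\<^sup>2"
    if "Y = chain r z" "r m = r 0 \<or> z n = z 0"
      and Y': "region_chain D Y'" "\<forall>c\<in>crossings D. band_flow out Y' c = band_flow out Y c" for Y Y' r z
  proof -
    from Y'(1) obtain r' z' where rz: "region_values m n r' z' Y'"
      by (auto simp: region_chain_iff)
    have rzY: "region_values m n r z Y"
      using that(1) region_values_chain by simp
    have "z' n - z' 0 = z n - z 0" "r' m - r' 0 = r m - r 0"
      using Y'(2) Inl_crossing[of 0] Inr_crossing[of 0] mn
        h_antiparallel_crossing(1)[OF uv(1) rz, of 0] h_antiparallel_crossing(1)[OF uv(1) rzY, of 0]
        v_antiparallel_crossing(1)[OF uv(2) rz, of 0] v_antiparallel_crossing(1)[OF uv(2) rzY, of 0]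
      by (auto split: if_splits)
    moreover from this have "(if u then 2 * (z' n - z' 0) * (r' 0 - r' m) else 0) = 0"
      "(if v then 2 * (r' m - r' 0) * (z' 0 - z' n) else 0) = 0"
      using that(2) by auto
    ultimately have "2 * (\<Sum>i<m. band_flow out Y' (Inl i) * corner_difference Y' (Inl i)) = k * (z n - z 0)\<^sup>2"
      "2 * (\<Sum>j<n. band_flow out Y' (Inr j) * corner_difference Y' (Inr j)) = l * (r m - r 0)\<^sup>2"
      using h_antiparallel_sum[OF uv(1) rz] v_antiparallel_sum[OF uv(2) rz] assms(1,2)
      by (simp_all add: parity)
    then show ?thesis
      by (simp add: seifert_pairing_boxes)
  qed
  assume kl: "k * l < 0"
  define Y where "Y = chain (\<lambda>_. 0) (\<lambda>j. if j = n then 1 else 0)"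
  define Z where "Z = chain (\<lambda>i. if i = m then 1 else 0) (\<lambda>_. 0)"
  have Yk: "2 * seifert_pairing D out Y' Y' = k"
    if "region_chain D Y'" "\<forall>c\<in>crossings D. band_flow out Y' c = band_flow out Y c" for Y'
    using form[OF Y_def _ that] mn by simp
  have Zl: "2 * seifert_pairing D out Z' Z' = l"
    if "region_chain D Z'" "\<forall>c\<in>crossings D. band_flow out Z' c = band_flow out Z c" for Z'
    using form[OF Z_def _ that] mn by simp
  have YZ: "region_chain D Y" "region_chain D Z"
    by (simp_all add: Y_def Z_def region_chain_chain)
  show "\<bar>matrix_signature (map_mat real_of_int (V + transpose_mat V))\<bar> \<le> 0"
  proof (cases "0 < k")
    case True
    then have "l < 0" using kl by (simp add: mult_less_0_iff)
    have "0 < seifert_pairing D out Y' Y'"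
      if "region_chain D Y'" "\<forall>c\<in>crossings D. band_flow out Y' c = band_flow out Y c" for Y'
      using Yk[OF that] True by linarith
    moreover have "seifert_pairing D out Z' Z' < 0"
      if "region_chain D Z'" "\<forall>c\<in>crossings D. band_flow out Z' c = band_flow out Z c" for Z'
      using Zl[OF that] \<open>l < 0\<close> by linarith
    ultimately show ?thesis
      using seifert_matrix_signature_indefinite_le[OF V C(1) det YZ(1) _ YZ(2)] C(2) by simp
  next
    case False
    then have "k < 0" "l > 0" using kl nz by (auto simp: mult_less_0_iff)
    have "0 < seifert_pairing D out Z' Z'"
      if "region_chain D Z'" "\<forall>c\<in>crossings D. band_flow out Z' c = band_flow out Z c" for Z'
      using Zl[OF that] \<open>l > 0\<close> by linarith
    moreover have "seifert_pairing D out Y' Y' < 0"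
      if "region_chain D Y'" "\<forall>c\<in>crossings D. band_flow out Y' c = band_flow out Y c" for Y'
      using Yk[OF that] \<open>k < 0\<close> by linarith
    ultimately show ?thesis
      using seifert_matrix_signature_indefinite_le[OF V C(1) det YZ(2) _ YZ(1)] C(2) by simp
  qed
qed

text \<open>The flow through a crossing of the antiparallel horizontal box is
  \<open>z n - z 0\<close> up to sign, the telescoped sum of flows through the parallel vertical
  box. So the \<open>n\<close> vertical crossings control the class, and the form depends only on
  the differences of \<open>z\<close>.\<close>

lemma signature_odd_even:
  assumes "odd k" "even l" and V: "seifert_matrix D out V"
  shows "\<bar>matrix_signature (map_mat real_of_int (V + transpose_mat V))\<bar> \<le> int n"
    and "0 < k * l \<Longrightarrow> \<bar>matrix_signature (map_mat real_of_int (V + transpose_mat V))\<bar> \<le> int n - 2"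
proof -
  from odd_even[OF assms(1,2)] obtain u where u: "h_antiparallel (\<not> u)" "v_parallel u"
    by blast
  define C where "C = (Inr ` {..<n} :: (nat + nat) set)"
  have C: "finite C" "card C = n"
    by (simp_all add: C_def card_image)
  have flow_eq: "(\<forall>j<n. z' (Suc j) - z' j = z (Suc j) - z j) \<and> z' n - z' 0 = z n - z 0"
    if "region_values m n r z Y" "region_values m n r' z' Y'"
      "\<forall>c\<in>C. band_flow out Y' c = band_flow out Y c" for r z Y r' z' Y'
  proof -
    have eq: "\<forall>j<n. z' (Suc j) - z' j = z (Suc j) - z j"
    proof (intro allI impI)
      fix j assume j: "j < n"
      then have "band_flow out Y' (Inr j) = band_flow out Y (Inr j)"
        using that(3) by (simp add: C_def)
      then show "z' (Suc j) - z' j = z (Suc j) - z j"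
        using v_parallel_crossing(1)[OF u(2) that(1) j] v_parallel_crossing(1)[OF u(2) that(2) j]
        by (cases u) auto
    qed
    moreover have "z' n - z' 0 = z n - z 0"
      unfolding sum_lessThan_telescope[symmetric] using eq by (intro sum.cong) auto
    ultimately show ?thesis by simp
  qed
  have det: "\<forall>c\<in>crossings D. band_flow out Y c = 0"
    if "region_chain D Y" "\<forall>c\<in>C. band_flow out Y c = 0" for Y
  proof -
    from that(1) obtain r z where rz: "region_values m n r z Y"
      by (auto simp: region_chain_iff)
    have zero: "region_values m n (\<lambda>_. 0) (\<lambda>_. 0) (\<lambda>_. 0)"
      by (simp add: region_values_def)
    have "\<forall>c\<in>C. band_flow out Y c = band_flow out (\<lambda>_. 0) c"
      using that(2) by (simp add: band_flow_def)
    from flow_eq[OF zero rz this] show ?thesis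
      using h_antiparallel_crossing(1)[OF u(1) rz] v_parallel_crossing(1)[OF u(2) rz]
      by (auto simp: crossings_D)
  qed
  show "\<bar>matrix_signature (map_mat real_of_int (V + transpose_mat V))\<bar> \<le> int n"
    using seifert_matrix_signature_le[OF V C(1) det] C(2) by simp
  have form: "2 * seifert_pairing D out Y' Y' = k * (z n - z 0)\<^sup>2 - sgn l * (\<Sum>j<n. (z (Suc j) - z j)\<^sup>2)"
    if Y': "region_chain D Y'" "\<forall>c\<in>crossings D. band_flow out Y' c = band_flow out (chain (\<lambda>_. 0) z) c"
    for Y' z
  proof -
    from Y'(1) obtain r' z' where rz: "region_values m n r' z' Y'"
      by (auto simp: region_chain_iff)
    have "\<forall>c\<in>C. band_flow out Y' c = band_flow out (chain (\<lambda>_. 0) z) c"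
      using Y'(2) by (auto simp: C_def crossings_D)
    from flow_eq[OF region_values_chain rz this]
    have eq: "\<forall>j<n. z' (Suc j) - z' j = z (Suc j) - z j" "z' n - z' 0 = z n - z 0"
      by auto
    have "2 * seifert_pairing D out Y' Y'
        = k * (z' n - z' 0)\<^sup>2 - sgn l * (\<Sum>j<n. (z' (Suc j) - z' j)\<^sup>2)"
      using h_antiparallel_sum[OF u(1) rz] v_parallel_sum[OF u(2) rz] assms(1)
      by (cases u) (simp_all add: seifert_pairing_boxes parity algebra_simps)
    then show ?thesis
      using eq by simp
  qed
  have n: "n \<ge> 2"
    using assms(2) mn parity by (auto elim!: evenE)
  show "\<bar>matrix_signature (map_mat real_of_int (V + transpose_mat V))\<bar> \<le> int n - 2" if "0 < k * l"
  proof -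
    have "\<bar>matrix_signature (map_mat real_of_int (V + transpose_mat V))\<bar> \<le> int (card C) - 2"
    proof (rule difference_form_signature_le[where Y = "\<lambda>f. chain (\<lambda>_. 0) f" and a = k and b = l and N = n,
          OF V C(1) _ _ _ that n])
      show "\<forall>c\<in>crossings D. band_flow out Y c = 0"
        if "region_chain D Y" "\<forall>c\<in>C. band_flow out Y c = 0" for Y
        using that by (rule det)
      show "region_chain D (chain (\<lambda>_. 0) f)" for f
        by (rule region_chain_chain)
      show "2 * seifert_pairing D out Y' Y' = k * (f n - f 0)\<^sup>2 - sgn l * (\<Sum>i<n. (f (Suc i) - f i)\<^sup>2)"
        if "region_chain D Y'" "\<forall>c\<in>crossings D. band_flow out Y' c = band_flow out (chain (\<lambda>_. 0) f) c" for f Y'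
        using that by (rule form)
    qed
    then show ?thesis
      using C(2) by simp
  qed
qed

lemma signature_even_odd:
  assumes "even k" "odd l" and V: "seifert_matrix D out V"
  shows "\<bar>matrix_signature (map_mat real_of_int (V + transpose_mat V))\<bar> \<le> int m"
    and "0 < k * l \<Longrightarrow> \<bar>matrix_signature (map_mat real_of_int (V + transpose_mat V))\<bar> \<le> int m - 2"
proof -
  from even_odd[OF assms(1,2)] obtain u where u: "h_parallel u" "v_antiparallel (\<not> u)"
    by blast
  define C where "C = (Inl ` {..<m} :: (nat + nat) set)"
  have C: "finite C" "card C = m"
    by (simp_all add: C_def card_image)
  have flow_eq: "(\<forall>i<m. r' (Suc i) - r' i = r (Suc i) - r i) \<and> r' m - r' 0 = r m - r 0"
    if "region_values m n r z Y" "region_values m n r' z' Y'"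
      "\<forall>c\<in>C. band_flow out Y' c = band_flow out Y c" for r z Y r' z' Y'
  proof -
    have eq: "\<forall>i<m. r' (Suc i) - r' i = r (Suc i) - r i"
    proof (intro allI impI)
      fix i assume i: "i < m"
      then have "band_flow out Y' (Inl i) = band_flow out Y (Inl i)"
        using that(3) by (simp add: C_def)
      then show "r' (Suc i) - r' i = r (Suc i) - r i"
        using h_parallel_crossing(1)[OF u(1) that(1) i] h_parallel_crossing(1)[OF u(1) that(2) i]
        by (cases u) auto
    qed
    moreover have "r' m - r' 0 = r m - r 0"
      unfolding sum_lessThan_telescope[symmetric] using eq by (intro sum.cong) auto
    ultimately show ?thesis by simp
  qed
  have det: "\<forall>c\<in>crossings D. band_flow out Y c = 0"
    if "region_chain D Y" "\<forall>c\<in>C. band_flow out Y c = 0" for Y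
  proof -
    from that(1) obtain r z where rz: "region_values m n r z Y"
      by (auto simp: region_chain_iff)
    have zero: "region_values m n (\<lambda>_. 0) (\<lambda>_. 0) (\<lambda>_. 0)"
      by (simp add: region_values_def)
    have "\<forall>c\<in>C. band_flow out Y c = band_flow out (\<lambda>_. 0) c"
      using that(2) by (simp add: band_flow_def)
    from flow_eq[OF zero rz this] show ?thesis
      using h_parallel_crossing(1)[OF u(1) rz] v_antiparallel_crossing(1)[OF u(2) rz]
      by (auto simp: crossings_D)
  qed
  show "\<bar>matrix_signature (map_mat real_of_int (V + transpose_mat V))\<bar> \<le> int m"
    using seifert_matrix_signature_le[OF V C(1) det] C(2) by simp
  have form: "2 * seifert_pairing D out Y' Y' = l * (r m - r 0)\<^sup>2 - sgn k * (\<Sum>i<m. (r (Suc i) - r i)\<^sup>2)"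
    if Y': "region_chain D Y'" "\<forall>c\<in>crossings D. band_flow out Y' c = band_flow out (chain r (\<lambda>_. 0)) c"
    for Y' r
  proof -
    from Y'(1) obtain r' z' where rz: "region_values m n r' z' Y'"
      by (auto simp: region_chain_iff)
    have "\<forall>c\<in>C. band_flow out Y' c = band_flow out (chain r (\<lambda>_. 0)) c"
      using Y'(2) by (auto simp: C_def crossings_D)
    from flow_eq[OF region_values_chain rz this]
    have eq: "\<forall>i<m. r' (Suc i) - r' i = r (Suc i) - r i" "r' m - r' 0 = r m - r 0"
      by auto
    have "2 * seifert_pairing D out Y' Y'
        = l * (r' m - r' 0)\<^sup>2 - sgn k * (\<Sum>i<m. (r' (Suc i) - r' i)\<^sup>2)"
      using h_parallel_sum[OF u(1) rz] v_antiparallel_sum[OF u(2) rz] assms(2)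
      by (cases u) (simp_all add: seifert_pairing_boxes parity algebra_simps)
    then show ?thesis
      using eq by simp
  qed
  have m: "m \<ge> 2"
    using assms(1) mn parity by (auto elim!: evenE)
  assume "0 < k * l"
  then have kl: "0 < l * k" by (simp add: mult.commute)
  show "\<bar>matrix_signature (map_mat real_of_int (V + transpose_mat V))\<bar> \<le> int m - 2"
  proof -
    have "\<bar>matrix_signature (map_mat real_of_int (V + transpose_mat V))\<bar> \<le> int (card C) - 2"
    proof (rule difference_form_signature_le[where Y = "\<lambda>f. chain f (\<lambda>_. 0)" and a = l and b = k and N = m,
          OF V C(1) _ _ _ kl m])
      show "\<forall>c\<in>crossings D. band_flow out Y c = 0"
        if "region_chain D Y" "\<forall>c\<in>C. band_flow out Y c = 0" for Y
        using that by (rule det)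
      show "region_chain D (chain f (\<lambda>_. 0))" for f
        by (rule region_chain_chain)
      show "2 * seifert_pairing D out Y' Y' = l * (f m - f 0)\<^sup>2 - sgn k * (\<Sum>i<m. (f (Suc i) - f i)\<^sup>2)"
        if "region_chain D Y'" "\<forall>c\<in>crossings D. band_flow out Y' c = band_flow out (chain f (\<lambda>_. 0)) c" for f Y'
        using that by (rule form)
    qed
    then show ?thesis
      using C(2) by simp
  qed
qed

end

section \<open>Words in the Riley matrices\<close>

text \<open>Matrices of this fixed size form a monoid as a type, so powers and
  \<open>prod_list\<close> apply without dimension conditions.\<close>

datatype 'a mat2 = Mat2 (m11: 'a) (m12: 'a) (m21: 'a) (m22: 'a)

instantiation mat2 :: (comm_ring_1) monoid_mult
begin

definition one_mat2 :: "'a mat2" where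
  "1 = Mat2 1 0 0 1"

definition times_mat2 :: "'a mat2 \<Rightarrow> 'a mat2 \<Rightarrow> 'a mat2" where
  "M * N = Mat2 (m11 M * m11 N + m12 M * m21 N) (m11 M * m12 N + m12 M * m22 N)
     (m21 M * m11 N + m22 M * m21 N) (m21 M * m12 N + m22 M * m22 N)"

instance
  by standard (simp_all add: one_mat2_def times_mat2_def algebra_simps)

end

lemma mat2_sel_simps [simp]:
  "m11 (1 :: 'a :: comm_ring_1 mat2) = 1" "m12 (1 :: 'a mat2) = 0"
  "m21 (1 :: 'a mat2) = 0" "m22 (1 :: 'a mat2) = 1"
  "m11 (M * N) = m11 M * m11 N + m12 M * m21 N" "m12 (M * N) = m11 M * m12 N + m12 M * m22 N"
  "m21 (M * N) = m21 M * m11 N + m22 M * m21 N" "m22 (M * N) = m21 M * m12 N + m22 M * m22 N"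
  for M N :: "'a :: comm_ring_1 mat2"
  by (simp_all add: one_mat2_def times_mat2_def)

definition to_mat :: "'a mat2 \<Rightarrow> 'a mat" where
  "to_mat M = mat_of_rows_list 2 [[m11 M, m12 M], [m21 M, m22 M]]"

lemma to_mat_one: "to_mat (1 :: 'a :: comm_ring_1 mat2) = 1\<^sub>m 2"
  by (auto simp: to_mat_def mat_of_rows_list_def less_2_cases_iff intro!: eq_matI)

lemma to_mat_mult: "to_mat (M * N) = to_mat M * to_mat (N :: 'a :: comm_ring_1 mat2)"
  by (auto simp: to_mat_def mat_of_rows_list_def less_Suc_eq numeral_2_eq_2 scalar_prod_def intro!: eq_matI)

text \<open>Here \<open>t\<close> stands for the inverse of \<open>s\<close> and \<open>u\<close>
  for \<open>2 - y\<close>. Keeping them independent lets one definition serve the complex Riley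
  matrices and, with \<open>s = t = 1\<close>, the real parabolic ones.\<close>

definition letter :: "'a \<Rightarrow> 'a \<Rightarrow> 'a \<Rightarrow> (nat \<Rightarrow> int) \<Rightarrow> nat \<Rightarrow> 'a :: comm_ring_1 mat2" where
  "letter s t u e j =
    (if odd j then if e j = 1 then Mat2 s 1 0 t else Mat2 t (- 1) 0 s
     else if e j = 1 then Mat2 s 0 u t else Mat2 t 0 (- u) s)"

definition word :: "'a \<Rightarrow> 'a \<Rightarrow> 'a \<Rightarrow> (nat \<Rightarrow> int) \<Rightarrow> nat list \<Rightarrow> 'a :: comm_ring_1 mat2" where
  "word s t u e js = prod_list (map (letter s t u e) js)"

lemma word_simps [simp]:
  "word s t u e [] = 1"
  "word s t u e (j # js) = letter s t u e j * word s t u e js"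
  "word s t u e (js @ js') = word s t u e js * word s t u e js'"
  by (simp_all add: word_def)

lemma word_cong:
  "(\<And>j. j \<in> set js \<Longrightarrow> e j = e' j) \<Longrightarrow> word s t u e js = word s t u e' js"
  unfolding word_def by (intro arg_cong[of _ _ prod_list] map_cong) (simp_all add: letter_def)

lemma riley_W_eq_word:
  "riley_W p q s y = to_mat (word s (inverse s) (2 - y) (schubert_sign p q) [1..<p])"
proof -
  have "to_mat (letter s (inverse s) (2 - y) e j) = (if odd j then riley_A s (e j) else riley_B s y (e j))"
    for e j
    by (simp add: letter_def riley_A_def riley_B_def to_mat_def)
  then have "to_mat (word s (inverse s) (2 - y) e js)
      = foldr (*) (map (\<lambda>j. if odd j then riley_A s (e j) else riley_B s y (e j)) js) (1\<^sub>m 2)" for e js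
    by (induction js) (simp_all add: to_mat_one to_mat_mult)
  then show ?thesis
    by (simp add: riley_W_def)
qed

lemma riley_tilde_eq_word:
  "riley_tilde p q s y =
    m11 (word s (inverse s) (2 - y) (schubert_sign p q) [1..<p]) +
    (inverse s - s) * m12 (word s (inverse s) (2 - y) (schubert_sign p q) [1..<p])"
  by (simp add: riley_tilde_def riley_W_eq_word to_mat_def mat_of_rows_list_def)

section \<open>Existence and uniqueness of the Riley polynomial\<close>

lemma poly_xy_simps [simp]:
  "poly_xy (P + Q) x y = poly_xy P x y + poly_xy Q x y"
  "poly_xy (P - Q) x y = poly_xy P x y - poly_xy Q x y"
  "poly_xy (P * Q) x y = poly_xy P x y * poly_xy Q x y"
  "poly_xy 1 x y = 1" "poly_xy 2 x y = 2"
  "poly_xy [:0, 1:] x y = x"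
  "poly_xy [:[:0, 1:]:] x y = y"
  by (simp_all add: poly_xy_def)

text \<open>Every complex \<open>x\<close> has the form \<open>s + inverse s\<close>, with
  \<open>s\<close> a root of s^2 - x s + 1. Thus \<open>P - Q\<close>, as a polynomial with
  coefficients in C[y], vanishes at infinitely many constants.\<close>

lemma poly_xy_unique:
  assumes "\<And>s y. s \<noteq> 0 \<Longrightarrow> poly_xy P (s + inverse s) y = poly_xy Q (s + inverse s) y"
  shows "P = Q"
proof -
  have eq: "poly_xy P x y = poly_xy Q x y" for x y
  proof -
    have "degree [:1, - x, 1:] = 2" by simp
    then obtain s where "poly [:1, - x, 1:] s = 0"
      using fundamental_theorem_of_algebra_alt[of "[:1, - x, 1:]"] by force
    then have s: "1 - x * s + s * s = 0" by (simp add: algebra_simps)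
    then have "s \<noteq> 0" by auto
    with s have "s + inverse s = x"
      by (simp add: field_simps)
    with assms[OF \<open>s \<noteq> 0\<close>, of y] show ?thesis by simp
  qed
  have "poly (P - Q) [:x:] = 0" for x
    using eq[of x] by (auto simp: poly_xy_def poly_eq_poly_eq_iff[symmetric] fun_eq_iff)
  moreover have "infinite (range (\<lambda>x::complex. [:x:]))"
    using infinite_UNIV_char_0 by (subst finite_image_iff) (auto simp: inj_on_def)
  ultimately have "infinite {a. poly (P - Q) a = 0}"
    by (metis (mono_tags, lifting) finite_subset image_subsetI mem_Collect_eq)
  then show "P = Q"
    using poly_roots_finite[of "P - Q"] by auto
qed

text \<open>
  The three functions \<open>tr W\<close>, \<open>tr WA\<close> and \<open>W\<^sub>1\<^sub>1 + (s\<inverse> - s) W\<^sub>1\<^sub>2\<close> are polynomials in \<open>s + s\<inverse>\<close> and \<open>y\<close>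
  for every palindromic word \<open>W\<close>: together they are closed under adding a letter at each end.
\<close>

lemma letter_extension:
  fixes M :: "'a :: comm_ring_1 mat2" and e :: "nat \<Rightarrow> int"
  assumes st: "s * t = 1" and M: "m21 M = u * m12 M" and ij: "even j \<longleftrightarrow> odd i" "e i = e j"
  defines "N \<equiv> letter s t u e i * M * letter s t u e j"
    and "T \<equiv> \<lambda>M. m11 M + m22 M" and "F \<equiv> \<lambda>M. m11 M + (t - s) * m12 M"
    and "R \<equiv> \<lambda>M. s * m11 M + u * m12 M + t * m22 M"
    and "x \<equiv> s + t"
  defines "R' \<equiv> if e j = 1 then R M else x * T M - R M"
  shows "m21 N = u * m12 N"
    and "T N = x * R' - T M + u * (if odd i then T M - F M else F M)"
    and "R N = (if e j = 1 then x * T N - R M else x * T M - R M)"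
    and "F N = (if odd i then T N - T M + F M else F M)"
proof -
  \<comment> \<open>Because \<open>m21 M = u * m12 M\<close>, the function \<open>R\<close> is the
    trace of \<open>M\<close> times A and also of \<open>M\<close> times B. As A + A^-1 and B + B^-1
    are both the scalar \<open>x\<close>, \<open>R'\<close> is the trace of \<open>M\<close> times
    the letter at \<open>j\<close>, whichever kind it is.\<close>
  obtain a b d where Mabd: "M = Mat2 a b (u * b) d"
    using M by (cases M) auto
  have st_left: "s * (t * z) = z" for z
    using st by (simp add: mult.assoc[symmetric])
  note defs = N_def T_def F_def R_def R'_def x_def Mabd letter_def
  show "m21 N = u * m12 N"
    and "T N = x * R' - T M + u * (if odd i then T M - F M else F M)"
    and "R N = (if e j = 1 then x * T N - R M else x * T M - R M)"
    and "F N = (if odd i then T N - T M + F M else F M)"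
    by (cases "odd i"; cases "e j = 1"; simp add: defs ij algebra_simps st st_left)+
qed

text \<open>The segment \<open>[h - r..<h + r]\<close> is symmetric under exchanging
  \<open>j\<close> and \<open>p - j\<close>. As \<open>p\<close> is odd, the two letters added in
  each step have equal signs, and one is a power of A, the other of B. This is the situation of
  \<open>letter_extension\<close>; it also makes the signs cancel in pairs.\<close>

lemma palindromic_word:
  fixes e :: "nat \<Rightarrow> int"
  assumes p: "p = 2 * h - 1" and h: "h \<ge> 1"
    and pal: "\<And>j. 0 < j \<Longrightarrow> j < p \<Longrightarrow> e (p - j) = e j"
    and e: "\<And>j. e j = 1 \<or> e j = - 1"
    and r: "r < h"
  shows "\<exists>T R F. \<forall>s y. s \<noteq> 0 \<longrightarrow>
    (let M = word s (inverse s) (2 - y) e [h - r..<h + r]; x = s + inverse s in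
      m21 M = (2 - y) * m12 M \<and> m11 M + m22 M = poly_xy T x y \<and>
      s * m11 M + (2 - y) * m12 M + inverse s * m22 M = poly_xy R x y \<and>
      m11 M + (inverse s - s) * m12 M = poly_xy F x y)"
    and "prod_list (map e [h - r..<h + r]) = 1"
proof -
  have list: "[h - Suc r..<h + Suc r] = (h - Suc r) # [h - r..<h + r] @ [h + r]" if "Suc r < h" for r
  proof -
    have "[h - Suc r..<h + Suc r] = (h - Suc r) # [Suc (h - Suc r)..<h + Suc r]"
      using that by (intro upt_conv_Cons) simp
    also have "Suc (h - Suc r) = h - r" using that by simp
    finally show ?thesis by simp
  qed
  have ends: "even (h + r) \<longleftrightarrow> odd (h - Suc r)" "e (h - Suc r) = e (h + r)" if "Suc r < h" for r
    using that pal[of "h + r"] p by (auto simp: algebra_simps)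
  show "prod_list (map e [h - r..<h + r]) = 1" using r
  proof (induction r)
    case (Suc r)
    then show ?case
      using list[OF Suc.prems] ends(2)[OF Suc.prems] e[of "h + r"] by auto
  qed simp
  show "\<exists>T R F. \<forall>s y. s \<noteq> 0 \<longrightarrow>
    (let M = word s (inverse s) (2 - y) e [h - r..<h + r]; x = s + inverse s in
      m21 M = (2 - y) * m12 M \<and> m11 M + m22 M = poly_xy T x y \<and>
      s * m11 M + (2 - y) * m12 M + inverse s * m22 M = poly_xy R x y \<and>
      m11 M + (inverse s - s) * m12 M = poly_xy F x y)"
    using r
  proof (induction r)
    case 0
    \<comment> \<open>For the empty word the trace is 2, the trace of A is \<open>x\<close>, and the
      third function is 1.\<close>
    show ?case
      by (rule exI[of _ 2], rule exI[of _ "[:0, 1:]"], rule exI[of _ 1])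
        (simp add: Let_def)
  next
    case (Suc r)
    from Suc.IH[OF Suc_lessD[OF Suc.prems]] obtain T R F where IH: "\<forall>s y. s \<noteq> 0 \<longrightarrow>
      (let M = word s (inverse s) (2 - y) e [h - r..<h + r]; x = s + inverse s in
        m21 M = (2 - y) * m12 M \<and> m11 M + m22 M = poly_xy T x y \<and>
        s * m11 M + (2 - y) * m12 M + inverse s * m22 M = poly_xy R x y \<and>
        m11 M + (inverse s - s) * m12 M = poly_xy F x y)"
      by blast
    define X U :: "complex poly poly" where "X = [:0, 1:]" and "U = 2 - [:[:0, 1:]:]"
    have XU: "poly_xy X x y = x" "poly_xy U x y = 2 - y" for x y
      by (simp_all add: X_def U_def)
    define i j where "i = h - Suc r" and "j = h + r"
    define R1 where "R1 = (if e j = 1 then R else X * T - R)"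
    define T' where "T' = X * R1 - T + U * (if odd i then T - F else F)"
    define R' where "R' = (if e j = 1 then X * T' - R else X * T - R)"
    define F' where "F' = (if odd i then T' - T + F else F)"
    show ?case
    proof (rule exI[of _ T'], rule exI[of _ R'], rule exI[of _ F'], intro allI impI)
      fix s y :: complex assume s: "s \<noteq> 0"
      define M where "M = word s (inverse s) (2 - y) e [h - r..<h + r]"
      have N: "word s (inverse s) (2 - y) e [h - Suc r..<h + Suc r]
          = letter s (inverse s) (2 - y) e i * M * letter s (inverse s) (2 - y) e j"
        unfolding list[OF Suc.prems] by (simp add: M_def i_def j_def mult.assoc)
      have M: "m21 M = (2 - y) * m12 M" "m11 M + m22 M = poly_xy T (s + inverse s) y"
        "s * m11 M + (2 - y) * m12 M + inverse s * m22 M = poly_xy R (s + inverse s) y"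
        "m11 M + (inverse s - s) * m12 M = poly_xy F (s + inverse s) y"
        using IH s by (simp_all add: M_def Let_def)
      have st: "s * inverse s = 1" using s by simp
      have ij: "even j \<longleftrightarrow> odd i" "e i = e j"
        using ends[OF Suc.prems] by (simp_all add: i_def j_def)
      note ext = letter_extension[where M = M and i = i and j = j and e = e, OF st M(1) ij, unfolded M(2-4)]
      show "let M = word s (inverse s) (2 - y) e [h - Suc r..<h + Suc r]; x = s + inverse s in
          m21 M = (2 - y) * m12 M \<and> m11 M + m22 M = poly_xy T' x y \<and>
          s * m11 M + (2 - y) * m12 M + inverse s * m22 M = poly_xy R' x y \<and>
          m11 M + (inverse s - s) * m12 M = poly_xy F' x y"
        unfolding Let_def N ext
        by (simp add: T'_def R'_def F'_def R1_def XU if_distrib[of "\<lambda>P. poly_xy P _ _"])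
    qed
  qed
qed

lemma riley_poly_at:
  assumes p: "odd p"
    and pal: "\<And>j. 0 < j \<Longrightarrow> j < p \<Longrightarrow>
      schubert_sign p (odd_representative p q) (p - j) = schubert_sign p (odd_representative p q) j"
    and s: "s \<noteq> 0"
  shows "poly_xy (riley_poly p q) (s + inverse s) y = riley_tilde p (odd_representative p q) s y"
proof -
  let ?e = "schubert_sign p (odd_representative p q)"
  obtain h where h: "p = 2 * h - 1" "h \<ge> 1"
    using p by (auto elim!: oddE intro: that[of "Suc _"])
  have e: "?e j = 1 \<or> ?e j = - 1" for j
    by (simp add: schubert_sign_def)
  have "[h - (h - 1)..<h + (h - 1)] = [1..<p]"
    using h by (simp add: mult_2)
  moreover have "h - 1 < h"
    using h by simp
  ultimately obtain T R F where "\<forall>s y. s \<noteq> 0 \<longrightarrow>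
      (let M = word s (inverse s) (2 - y) ?e [1..<p]; x = s + inverse s in
        m21 M = (2 - y) * m12 M \<and> m11 M + m22 M = poly_xy T x y \<and>
        s * m11 M + (2 - y) * m12 M + inverse s * m22 M = poly_xy R x y \<and>
        m11 M + (inverse s - s) * m12 M = poly_xy F x y)"
    using palindromic_word(1)[where e = ?e and r = "h - 1", OF h pal e] by auto
  then have F: "riley_tilde p (odd_representative p q) s y = poly_xy F (s + inverse s) y" if "s \<noteq> 0" for s y
    using that by (simp add: Let_def riley_tilde_eq_word)
  have "\<exists>!\<Phi>. \<forall>s y. s \<noteq> 0 \<longrightarrow>
      poly_xy \<Phi> (s + inverse s) y = riley_tilde p (odd_representative p q) s y"
  proof (rule ex1I[of _ F])
    show "\<forall>s y. s \<noteq> 0 \<longrightarrow> poly_xy F (s + inverse s) y = riley_tilde p (odd_representative p q) s y"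
      using F by simp
    show "\<Phi> = F" if "\<forall>s y. s \<noteq> 0 \<longrightarrow>
        poly_xy \<Phi> (s + inverse s) y = riley_tilde p (odd_representative p q) s y" for \<Phi>
      using that F by (intro poly_xy_unique) simp
  qed
  from theI'[OF this] s show ?thesis
    unfolding riley_poly_def by blast
qed

section \<open>Parabolic words over the reals\<close>

definition signs :: "(nat \<Rightarrow> int) \<Rightarrow> bool" where
  "signs e \<longleftrightarrow> (\<forall>j. e j = 1 \<or> e j = - 1)"

lemma letter_parabolic:
  assumes "signs e"
  shows "letter 1 1 u e j =
    (if odd j then Mat2 1 (of_int (e j)) 0 1 else Mat2 1 0 (of_int (e j) * u) 1)"
  using assms by (auto simp: letter_def signs_def)

lemma word_of_real:
  assumes "signs e"
  shows "word 1 1 (complex_of_real u) e js =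
    (let M = word 1 1 u e js in Mat2 (of_real (m11 M)) (of_real (m12 M)) (of_real (m21 M)) (of_real (m22 M)))"
  by (induction js) (simp_all add: letter_parabolic[OF assms] one_mat2_def times_mat2_def Let_def)

text \<open>Inverting all letters is conjugation by diag(1, -1) at \<open>s = 1\<close>. It fixes
  \<open>m11\<close>, so a sign common to all exponents has no effect on the roots.\<close>

lemma word_uminus:
  assumes "signs e"
  shows "word 1 1 u (\<lambda>j. - e j) js =
    (let M = word 1 1 u e js in Mat2 (m11 M) (- m12 M) (- m21 M) (m22 M))"
proof -
  have "signs (\<lambda>j. - e j)"
    using assms by (auto simp: signs_def)
  then show ?thesis
    by (induction js)
      (simp_all add: letter_parabolic assms one_mat2_def times_mat2_def Let_def algebra_simps)
qed

lemma word_zero: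
  fixes e :: "nat \<Rightarrow> int" and js :: "nat list"
  defines "M \<equiv> word 1 1 (0 :: real) e js"
  assumes "signs e"
  shows "m11 M = 1 \<and> m21 M = 0 \<and> m22 M = 1"
  unfolding M_def
  by (induction js) (simp_all add: letter_parabolic[OF assms(2)])

lemma word_det:
  assumes "signs e"
  shows "m11 (word 1 1 u e js) * m22 (word 1 1 u e js) - m12 (word 1 1 u e js) * m21 (word 1 1 u e js) = 1"
proof (induction js)
  case (Cons j js)
  then show ?case
    by (simp add: letter_parabolic[OF assms] algebra_simps)
qed simp

lemma continuous_on_word:
  fixes S :: "real set"
  assumes "signs e"
  shows "continuous_on S (\<lambda>y. m11 (word 1 1 (2 - y) e js))"
    "continuous_on S (\<lambda>y. m12 (word 1 1 (2 - y) e js))"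
    "continuous_on S (\<lambda>y. m21 (word 1 1 (2 - y) e js))"
    "continuous_on S (\<lambda>y. m22 (word 1 1 (2 - y) e js))"
proof (induction js)
  case (Cons j js)
  {
    case 1 show ?case
      using Cons by (cases "odd j") (simp_all add: letter_parabolic[OF assms] continuous_intros)
  next
    case 2 show ?case
      using Cons by (cases "odd j") (simp_all add: letter_parabolic[OF assms] continuous_intros)
  next
    case 3 show ?case
      using Cons by (cases "odd j") (simp_all add: letter_parabolic[OF assms] continuous_intros)
  next
    case 4 show ?case
      using Cons by (cases "odd j") (simp_all add: letter_parabolic[OF assms] continuous_intros)
  }
qed simp_all

text \<open>By Cayley-Hamilton, \<open>M ^ n\<close> is (sin(n \<phi>) M - sin((n - 1) \<phi>) 1) /
  sin \<phi>. If n \<phi> = \<pi> i, the first term vanishes and the second is the scalar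
  (-1)^i.\<close>

lemma elliptic_power:
  fixes M :: "real mat2"
  assumes det: "m11 M * m22 M - m12 M * m21 M = 1" and tr: "m11 M + m22 M = 2 * cos \<phi>"
    and sin: "sin \<phi> \<noteq> 0" and n: "n > 0" "real n * \<phi> = pi * real i"
  shows "M ^ n = Mat2 ((- 1) ^ i) 0 0 ((- 1) ^ i)"
proof -
  define c where "c = 2 * cos \<phi>"
  have rec: "M * M = Mat2 (c * m11 M - 1) (c * m12 M) (c * m21 M) (c * m22 M - 1)"
    unfolding times_mat2_def c_def tr[symmetric] using det by (simp add: algebra_simps)
  have sins: "sin (real (Suc (Suc k)) * \<phi>) = c * sin (real (Suc k) * \<phi>) - sin (real k * \<phi>)" for k
    using sin_add[of "real (Suc k) * \<phi>" \<phi>] sin_diff[of "real (Suc k) * \<phi>" \<phi>]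
    by (simp add: c_def algebra_simps)
  have pow: "M ^ Suc k = Mat2
      ((sin (real (Suc k) * \<phi>) * m11 M - sin (real k * \<phi>)) / sin \<phi>)
      (sin (real (Suc k) * \<phi>) * m12 M / sin \<phi>)
      (sin (real (Suc k) * \<phi>) * m21 M / sin \<phi>)
      ((sin (real (Suc k) * \<phi>) * m22 M - sin (real k * \<phi>)) / sin \<phi>)" for k
  proof (induction k)
    case 0
    then show ?case using sin by (cases M) (simp add: times_mat2_def one_mat2_def)
  next
    case (Suc k)
    define x y where "x = sin (real (Suc k) * \<phi>) / sin \<phi>" and "y = sin (real k * \<phi>) / sin \<phi>"
    have pk: "M ^ Suc k = Mat2 (x * m11 M - y) (x * m12 M) (x * m21 M) (x * m22 M - y)"
      unfolding Suc.IH by (simp add: x_def y_def diff_divide_distrib)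
    have x': "sin (real (Suc (Suc k)) * \<phi>) / sin \<phi> = c * x - y"
      unfolding sins by (simp add: x_def y_def diff_divide_distrib)
    have MM: "m11 M * m11 M + m12 M * m21 M = c * m11 M - 1" "m11 M * m12 M + m12 M * m22 M = c * m12 M"
      "m21 M * m11 M + m22 M * m21 M = c * m21 M" "m21 M * m12 M + m22 M * m22 M = c * m22 M - 1"
      using rec by (simp_all add: times_mat2_def)
    have "M ^ Suc (Suc k) = M * M ^ Suc k"
      by (rule power_Suc)
    also have "\<dots> = Mat2 (x * (m11 M * m11 M + m12 M * m21 M) - y * m11 M)
        (x * (m11 M * m12 M + m12 M * m22 M) - y * m12 M)
        (x * (m21 M * m11 M + m22 M * m21 M) - y * m21 M)
        (x * (m21 M * m12 M + m22 M * m22 M) - y * m22 M)"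
      unfolding pk by (simp add: times_mat2_def algebra_simps)
    also have "\<dots> = Mat2 ((c * x - y) * m11 M - x) ((c * x - y) * m12 M)
        ((c * x - y) * m21 M) ((c * x - y) * m22 M - x)"
      unfolding MM by (simp add: algebra_simps)
    finally show ?case
      unfolding x'[symmetric] by (simp add: x_def diff_divide_distrib)
  qed
  from n(1) obtain k where k: "n = Suc k" by (cases n) auto
  have sn: "sin (real (Suc k) * \<phi>) = 0"
    using n(2) unfolding k by (simp add: mult.commute)
  have "real k * \<phi> = pi * real i - \<phi>"
    using n(2) unfolding k by (simp add: algebra_simps)
  then have "sin (real k * \<phi>) = sin (pi * real i - \<phi>)"
    by simp
  also have "\<dots> = - ((- 1) ^ i * sin \<phi>)"
    unfolding sin_diff by (simp add: mult.commute[of pi])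
  finally show ?thesis
    unfolding k pow sn using sin by simp
qed

text \<open>The value \<open>u = -8\<close> is far enough on the hyperbolic side for every letter to dominate.\<close>

lemma hyperbolic_row:
  fixes f g \<sigma> a b :: real
  assumes "\<sigma> = 1 \<or> \<sigma> = - 1" "a = 1 \<or> a = - 1" "b = 1 \<or> b = - 1"
    and "6 * \<bar>g\<bar> \<le> \<sigma> * f"
  shows "6 * \<bar>f * a + g\<bar> \<le> - (\<sigma> * a * b) * (f + (f * a + g) * (b * - 8))"
    and "5 * (\<sigma> * f) \<le> - (\<sigma> * a * b) * (f + (f * a + g) * (b * - 8))"
  \<comment> \<open>Since |g| <= |f| / 6, the new second entry h = f a + g satisfies |h| >= 5/6 |f|.
    The new first entry is at least 8 |h| - |f| in absolute value, which is at least 34/5 |h| and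
    17/3 |f|; this leaves room for the constants 6 and 5.\<close>
  using assms by (auto simp: abs_if split: if_splits)

lemma word_Suc_Suc: "word s t u e [a..<a + 2 * Suc r] =
    word s t u e [a..<a + 2 * r] * letter s t u e (a + 2 * r) * letter s t u e (Suc (a + 2 * r))"
  by (simp add: mult.assoc)

text \<open>The first entry of a row is dominant and gets multiplied by roughly -8 times the two
  signs of each new pair of letters; \<open>\<sigma>\<close> collects the resulting sign. The second
  row starts as (0, 1), so its dominance sets in only after the first pair.\<close>

lemma hyperbolic_word_rows:
  fixes e :: "nat \<Rightarrow> int"
  assumes e: "signs e" and a: "odd a"
  defines "M \<equiv> \<lambda>r. word 1 1 (- 8 :: real) e [a..<a + 2 * r]"
    and "\<sigma> \<equiv> \<lambda>r. (- 1) ^ r * real_of_int (prod_list (map e [a..<a + 2 * r]))"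
  shows "6 * \<bar>m12 (M r)\<bar> \<le> \<sigma> r * m11 (M r)" and "5 ^ r \<le> \<sigma> r * m11 (M r)"
    and "r > 0 \<Longrightarrow> 6 * \<bar>m22 (M r)\<bar> \<le> \<bar>m21 (M r)\<bar>"
proof -
  have pm: "real_of_int (e j) = 1 \<or> real_of_int (e j) = - 1" for j
    using e unfolding signs_def by (metis of_int_1 of_int_minus)
  have prod_pm: "real_of_int (prod_list (map e js)) = 1 \<or> real_of_int (prod_list (map e js)) = - 1" for js
  proof (induction js)
    case (Cons j js)
    then show ?case using pm[of j] by auto
  qed simp
  have \<sigma>: "\<sigma> r = 1 \<or> \<sigma> r = - 1" for r
    using prod_pm[of "[a..<a + 2 * r]"] minus_one_power_iff[of r, where 'a = real]
    by (auto simp: \<sigma>_def split: if_splits)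
  have Suc_M: "M (Suc r) = M r * letter 1 1 (- 8) e (a + 2 * r) * letter 1 1 (- 8) e (Suc (a + 2 * r))" for r
    unfolding M_def by (rule word_Suc_Suc)
  have Suc_\<sigma>: "\<sigma> (Suc r) = - (\<sigma> r * e (a + 2 * r) * e (Suc (a + 2 * r)))" for r
    by (simp add: \<sigma>_def)
  have odd: "odd (a + 2 * r)" for r using a by simp
  have entries: "m11 (M (Suc r)) = m11 (M r) + (m11 (M r) * e (a + 2 * r) + m12 (M r)) * (real_of_int (e (Suc (a + 2 * r))) * - 8)"
    "m12 (M (Suc r)) = m11 (M r) * e (a + 2 * r) + m12 (M r)"
    "m21 (M (Suc r)) = m21 (M r) + (m21 (M r) * e (a + 2 * r) + m22 (M r)) * (real_of_int (e (Suc (a + 2 * r))) * - 8)"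
    "m22 (M (Suc r)) = m21 (M r) * e (a + 2 * r) + m22 (M r)" for r
    using odd[of r] by (simp_all add: Suc_M letter_parabolic[OF e])
  have "6 * \<bar>m12 (M r)\<bar> \<le> \<sigma> r * m11 (M r) \<and> 5 ^ r \<le> \<sigma> r * m11 (M r)"
  proof (induction r)
    case 0
    show ?case by (simp add: M_def \<sigma>_def)
  next
    case (Suc r)
    note row = hyperbolic_row[OF \<sigma>[of r] pm[of "a + 2 * r"] pm[of "Suc (a + 2 * r)"] conjunct1[OF Suc.IH]]
    show ?case
      using row Suc.IH unfolding Suc_\<sigma> entries by simp
  qed
  then show "6 * \<bar>m12 (M r)\<bar> \<le> \<sigma> r * m11 (M r)" and "5 ^ r \<le> \<sigma> r * m11 (M r)"
    by auto
  show "6 * \<bar>m22 (M r)\<bar> \<le> \<bar>m21 (M r)\<bar>" if "r > 0"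
    using that
  proof (induction r)
    case (Suc r)
    show ?case
    proof (cases "r = 0")
      case True
      then have "M r = 1" by (simp add: M_def)
      then show ?thesis
        using pm[of "Suc (a + 2 * r)"] unfolding entries by auto
    next
      case False
      with Suc have IH: "6 * \<bar>m22 (M r)\<bar> \<le> \<bar>m21 (M r)\<bar>" by simp
      \<comment> \<open>For the second row only absolute values matter; \<open>\<tau>\<close>
        supplies the sign that \<open>hyperbolic_row\<close> expects.\<close>
      define \<tau> where "\<tau> = (if m21 (M r) \<ge> 0 then 1 else - 1 :: real)"
      have \<tau>: "\<tau> = 1 \<or> \<tau> = - 1" "6 * \<bar>m22 (M r)\<bar> \<le> \<tau> * m21 (M r)"
        using IH by (auto simp: \<tau>_def)
      have abs: "x \<le> \<bar>y\<bar>" if "x \<le> - (\<tau> * a * b) * y" "a = 1 \<or> a = - 1" "b = 1 \<or> b = - 1" for x y a b :: real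
        using that \<tau>(1) by auto
      show ?thesis
        unfolding entries
        by (rule abs[OF hyperbolic_row(1)[OF \<tau>(1) pm pm \<tau>(2)] pm pm])
    qed
  qed simp
qed

text \<open>Left multiplication acts on columns, so pairs of letters are prepended. From |y| <= 4/3
  |x| the new lower entry is at least 20/3 |x| in absolute value, and the new upper entry differs
  from it, up to sign, by \<open>x\<close>. The new ratio is thus at most 20/17, below 4/3.\<close>

lemma hyperbolic_word_column:
  fixes e :: "nat \<Rightarrow> int"
  assumes e: "signs e" and a: "odd a"
  defines "M \<equiv> \<lambda>a r. word 1 1 (- 8 :: real) e [a..<a + 2 * r]"
  shows "3 * \<bar>m21 (M a r)\<bar> \<le> 4 * \<bar>m11 (M a r)\<bar>"
  using a
proof (induction r arbitrary: a)
  case 0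
  then show ?case by (simp add: M_def)
next
  case (Suc r)
  have pm: "real_of_int (e j) = 1 \<or> real_of_int (e j) = - 1" for j
    using e unfolding signs_def by (metis of_int_1 of_int_minus)
  have "[a..<a + 2 * Suc r] = a # Suc a # [Suc (Suc a)..<Suc (Suc a) + 2 * r]"
    by (simp add: upt_conv_Cons)
  then have M: "M a (Suc r) = letter 1 1 (- 8) e a * (letter 1 1 (- 8) e (Suc a) * M (Suc (Suc a)) r)"
    by (simp add: M_def)
  define x y where "x = m11 (M (Suc (Suc a)) r)" and "y = m21 (M (Suc (Suc a)) r)"
  have IH: "3 * \<bar>y\<bar> \<le> 4 * \<bar>x\<bar>"
    using Suc.IH[of "Suc (Suc a)"] Suc.prems by (simp add: x_def y_def)
  have entries: "m21 (M a (Suc r)) = e (Suc a) * - 8 * x + y"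
    "m11 (M a (Suc r)) = x + e a * (e (Suc a) * - 8 * x + y)"
    using Suc.prems by (simp_all add: M letter_parabolic[OF e] x_def y_def)
  show ?case
    unfolding entries using IH pm[of a] pm[of "Suc a"]
    by (auto simp: abs_if split: if_splits)
qed

text \<open>The row and column estimates combine to |m22| <= |m21| / 6 <= 2/9 |m11|, while
  \<open>m11\<close> is at most -5; so the trace is at most -35/9.\<close>

lemma hyperbolic_word_trace:
  fixes e :: "nat \<Rightarrow> int"
  assumes e: "signs e" and a: "odd a" and r: "r > 0"
    and neg: "(- 1) ^ r * prod_list (map e [a..<a + 2 * r]) = - 1"
  shows "m11 (word 1 1 (- 8 :: real) e [a..<a + 2 * r]) + m22 (word 1 1 (- 8) e [a..<a + 2 * r]) \<le> - 2"
proof -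
  let ?M = "word 1 1 (- 8 :: real) e [a..<a + 2 * r]"
  have "(- 1) ^ r * real_of_int (prod_list (map e [a..<a + 2 * r])) = - 1"
    using neg by (metis of_int_1 of_int_minus of_int_mult of_int_power)
  with hyperbolic_word_rows(2)[OF e a, of r] have "5 ^ r \<le> - m11 ?M"
    by simp
  moreover have "(5::real) \<le> 5 ^ r"
    using power_increasing[of 1 r "5::real"] r by simp
  ultimately show ?thesis
    using hyperbolic_word_rows(3)[OF e a r] hyperbolic_word_column[OF e a, of r]
    by (auto simp: abs_if split: if_splits)
qed

section \<open>Products over blocks of consecutive indices\<close>

lemma prod_list_upt_blocks:
  fixes f :: "nat \<Rightarrow> 'a :: monoid_mult"
  shows "prod_list (map f [c..<c + N * n]) = prod_list (map (\<lambda>b. prod_list (map f [c + N * b..<c + N * b + N])) [0..<n])"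
proof (induction n)
  case (Suc n)
  have "[c..<c + N * Suc n] = [c..<c + N * n] @ [c + N * n..<c + N * n + N]"
    using upt_add_eq_append[of c "c + N * n" N] by (simp add: algebra_simps)
  with Suc show ?case by simp
qed simp

lemma prod_list_upt_shift:
  "prod_list (map f [c + d..<c + d + N]) = prod_list (map (\<lambda>j. f (j + d)) [c..<c + N])"
  for f :: "nat \<Rightarrow> 'a :: monoid_mult"
  by (induction N) (simp_all add: add.commute add.left_commute)

lemma prod_list_upt_periodic:
  fixes f :: "nat \<Rightarrow> 'a :: monoid_mult"
  assumes per: "\<And>j. c \<le> j \<Longrightarrow> f (j + N) = f j"
  shows "prod_list (map f [c..<c + N * n]) = prod_list (map f [c..<c + N]) ^ n"
proof -
  have per': "f (j + N * b) = f j" if "c \<le> j" for b j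
    using that
  proof (induction b)
    case (Suc b)
    then show ?case using per[of "j + N * b"] by (simp add: algebra_simps)
  qed simp
  have "prod_list (map f [c + N * b..<c + N * b + N]) = prod_list (map f [c..<c + N])" for b
    unfolding prod_list_upt_shift using per' by (intro arg_cong[of _ _ prod_list] map_cong) auto
  then show ?thesis
    by (simp add: prod_list_upt_blocks) (induction n; simp add: power_commutes)
qed

section \<open>Schubert signs of double twist knots\<close>

lemma div_mod_nat_eqI:
  fixes a :: nat
  assumes "a = r + i * p" "r < p"
  shows "a div p = i" "a mod p = r"
  using assms by auto

text \<open>L / (K L + 1) lies just below 1 / K, so the quotient jumps one step after each multiple
  of \<open>K\<close>. For j = i K + r + 1 the remainder is (r + 1) L - i.\<close>

lemma
  fixes K L j :: nat
  assumes "K > 0" "L > 0" "0 < j" "j < K * L + 1"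
  shows div_mult_plus_one: "j * L div (K * L + 1) = (j - 1) div K"
    and not_dvd_mult_plus_one: "\<not> (K * L + 1) dvd j * L"
proof -
  define i r where "i = (j - 1) div K" and "r = (j - 1) mod K"
  have j: "j = i * K + r + 1"
    using assms by (simp add: i_def r_def)
  have r: "r < K" using assms by (simp add: r_def)
  have i: "i < L"
    unfolding i_def using assms by (simp add: less_mult_imp_div_less mult.commute)
  have "(r + 1) * L \<ge> 1 * L" "(r + 1) * L \<le> K * L"
    using r by (intro mult_right_mono; simp)+
  then have b: "i < (r + 1) * L" "(r + 1) * L - i < K * L + 1"
    using i by linarith+
  have eq: "j * L = ((r + 1) * L - i) + i * (K * L + 1)"
    using b(1) unfolding j by (simp add: algebra_simps)
  show "j * L div (K * L + 1) = (j - 1) div K"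
    using div_mod_nat_eqI(1)[OF eq b(2)] by (simp add: i_def)
  have "j * L mod (K * L + 1) = (r + 1) * L - i"
    by (rule div_mod_nat_eqI(2)[OF eq b(2)])
  then show "\<not> (K * L + 1) dvd j * L"
    using b(1) by (simp add: dvd_eq_mod_eq_0)
qed

text \<open>L / (K L - 1) lies just above 1 / K, so the quotient jumps at the multiples of
  \<open>K\<close> themselves; the remainder is i + r L. Hence blocks start at index 0 here and at
  index 1 in the previous case.\<close>

lemma
  fixes K L j :: nat
  assumes "K > 0" "L > 0" "0 < j" "j < K * L - 1"
  shows div_mult_minus_one: "j * L div (K * L - 1) = j div K"
    and not_dvd_mult_minus_one: "\<not> (K * L - 1) dvd j * L"
proof -
  define i r where "i = j div K" and "r = j mod K"
  have j: "j = i * K + r"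
    using assms by (simp add: i_def r_def)
  have r: "r < K" using assms by (simp add: r_def)
  have i: "i < L"
    unfolding i_def using assms by (simp add: less_mult_imp_div_less mult.commute)
  have b: "i + r * L < K * L - 1"
  proof (cases "r + 1 = K")
    case True
    \<comment> \<open>Both \<open>r + 1 = K\<close> and \<open>i + 1 = L\<close> would mean
      \<open>j = K * L - 1\<close>, which is out of range.\<close>
    then have "i + 1 \<noteq> L"
      using assms(4) unfolding j by (auto simp: algebra_simps)
    then have "i + 2 \<le> L" using i by simp
    moreover have "K * L = r * L + L" using True by (auto simp: algebra_simps)
    ultimately show ?thesis by simp
  next
    case False
    then have "(r + 2) * L \<le> K * L" using r by (intro mult_right_mono) auto
    then show ?thesis using i by simp
  qed
  have pos: "i + r * L > 0"
    using assms(2,3) unfolding j by (cases "i = 0") auto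
  have eq: "j * L = (i + r * L) + i * (K * L - 1)"
  proof -
    have "i * (K * L - 1) + i = i * (K * L)"
      using assms(1,2) by (cases "K * L") auto
    then show ?thesis unfolding j by (simp add: algebra_simps)
  qed
  show "j * L div (K * L - 1) = j div K"
    using div_mod_nat_eqI(1)[OF eq b] by (simp add: i_def)
  have "j * L mod (K * L - 1) = i + r * L"
    by (rule div_mod_nat_eqI(2)[OF eq b])
  then show "\<not> (K * L - 1) dvd j * L"
    using pos by (simp add: dvd_eq_mod_eq_0)
qed

text \<open>Replacing \<open>j\<close> by \<open>p - j\<close> turns the floor f into q - 1 - f, and
  q - 1 is even.\<close>

lemma schubert_sign_palindrome:
  assumes q: "odd q" and j: "0 < j" "j < p" and ndvd: "\<not> int p dvd int j * q"
  shows "schubert_sign p q (p - j) = schubert_sign p q j"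
proof -
  have "int (p - j) * q = - (int j * q) + q * int p"
    using j by (simp add: of_nat_diff algebra_simps)
  then have "int (p - j) * q div int p = q + - (int j * q) div int p"
    using j div_mult_self1[of "int p" "- (int j * q)" q] by (simp only:)
  also have "- (int j * q) div int p = - (int j * q div int p) - 1"
    using ndvd j by (simp add: zdiv_zminus1_eq_if dvd_eq_mod_eq_0)
  finally show ?thesis
    using q by (simp add: schubert_sign_def)
qed

text \<open>The term \<open>(L + 1) * j\<close> accounts for the odd representative: if
  \<open>L\<close> is even, \<open>p\<close> is added to \<open>q\<close> and the floor grows by
  \<open>j\<close>; if \<open>L\<close> is odd, the term is even.\<close>

definition block_sign :: "nat \<Rightarrow> nat \<Rightarrow> nat \<Rightarrow> int" where
  "block_sign p L j = (- 1) ^ ((L + 1) * j + j * L div p)"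

lemma signs_block_sign: "signs (block_sign p L)"
  by (simp add: signs_def block_sign_def minus_one_power_iff)

text \<open>Passing from \<open>L\<close> to \<open>- L\<close> turns a floor f into - f - 1 when
  the division is not exact, so a negative \<open>q\<close> flips all signs simultaneously.\<close>

lemma schubert_sign_odd_representative:
  assumes p: "odd p" and q: "\<bar>q\<bar> = int L" and ndvd: "\<not> p dvd j * L"
  shows "schubert_sign p (odd_representative p q) j = (if q < 0 then - 1 else 1) * block_sign p L j"
proof -
  have ndvd': "\<not> int p dvd int j * int L"
    using ndvd by (simp flip: of_nat_mult)
  have p0: "p > 0" using p by (cases p) auto
  have div: "int j * q div int p = (if q < 0 then - int (j * L div p) - 1 else int (j * L div p))"
  proof (cases "q < 0")
    case True
    then have "q = - int L" using q by simp
    then have "int j * q = - (int j * int L)" by simp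
    then show ?thesis
      using True ndvd' p0 by (simp add: zdiv_zminus1_eq_if dvd_eq_mod_eq_0 zdiv_int)
  next
    case False
    then show ?thesis using q by (simp add: zdiv_int)
  qed
  have parity: "even q \<longleftrightarrow> even L"
    using q by (metis even_abs_add_iff even_of_nat even_plus_one_iff dvd_abs_iff)
  have "int j * (q + int p) div int p = int j + int j * q div int p"
    using p0 by (simp add: distrib_left)
  then show ?thesis
    unfolding schubert_sign_def odd_representative_def block_sign_def
    using parity by (auto simp: div minus_one_power_iff)
qed

context
  fixes p L :: nat and q :: int
  assumes p: "odd p" and q: "\<bar>q\<bar> = int L"
    and ndvd: "\<And>j. 0 < j \<Longrightarrow> j < p \<Longrightarrow> \<not> p dvd j * L"
begin

lemma schubert_sign_pal:
  assumes "0 < j" "j < p"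
  shows "schubert_sign p (odd_representative p q) (p - j) = schubert_sign p (odd_representative p q) j"
proof (rule schubert_sign_palindrome[OF _ assms])
  show "odd (odd_representative p q)"
    using p by (simp add: odd_representative_def)
  have "int p dvd int j * q \<longleftrightarrow> int p dvd int j * \<bar>q\<bar>"
    by (cases "q < 0") simp_all
  also have "\<dots> \<longleftrightarrow> p dvd j * L"
    unfolding q by (simp flip: of_nat_mult)
  finally have "\<not> int p dvd int j * q"
    using ndvd[OF assms] by simp
  moreover have "int p dvd int j * (q + int p) \<longleftrightarrow> int p dvd int j * q"
    by (simp add: distrib_left dvd_add_left_iff)
  ultimately show "\<not> int p dvd int j * odd_representative p q"
    by (simp add: odd_representative_def)
qed

lemma riley_poly_2:
  "poly_xy (riley_poly p q) 2 (complex_of_real y)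
    = complex_of_real (m11 (word 1 1 (2 - y) (block_sign p L) [1..<p]))"
proof -
  define e where "e = (\<lambda>j. (if q < 0 then - 1 else 1) * block_sign p L j)"
  have "signs e"
    using signs_block_sign[of p L] by (auto simp: signs_def e_def)
  have "poly_xy (riley_poly p q) (1 + inverse 1) (complex_of_real y)
      = m11 (word 1 1 (complex_of_real (2 - y)) (schubert_sign p (odd_representative p q)) [1..<p])"
    using riley_poly_at[OF p schubert_sign_pal, of 1] by (simp add: riley_tilde_eq_word)
  also have "word 1 1 (complex_of_real (2 - y)) (schubert_sign p (odd_representative p q)) [1..<p]
      = word 1 1 (complex_of_real (2 - y)) e [1..<p]"
    using schubert_sign_odd_representative[OF p q ndvd] by (intro word_cong) (simp add: e_def)
  also have "m11 \<dots> = complex_of_real (m11 (word 1 1 (2 - y) e [1..<p]))"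
    unfolding word_of_real[OF \<open>signs e\<close>] Let_def by simp
  also have "m11 (word 1 1 (2 - y) e [1..<p]) = m11 (word 1 1 (2 - y) (block_sign p L) [1..<p])"
    using word_uminus[OF signs_block_sign, of "2 - y" p L "[1..<p]"]
    by (cases "q < 0") (simp_all add: e_def Let_def)
  finally show ?thesis by simp
qed

lemma block_sign_prod: "prod_list (map (block_sign p L) [1..<p]) = 1"
proof -
  obtain h where h: "p = 2 * h - 1" "h \<ge> 1"
    using p by (auto elim!: oddE intro: that[of "Suc _"])
  have pal: "block_sign p L (p - j) = block_sign p L j" if j: "0 < j" "j < p" for j
    using schubert_sign_pal[OF j] schubert_sign_odd_representative[OF p q ndvd[OF j]]
      schubert_sign_odd_representative[OF p q ndvd[of "p - j"]] j by (simp split: if_splits)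
  have "[h - (h - 1)..<h + (h - 1)] = [1..<p]" "h - 1 < h"
    using h by (simp_all add: mult_2)
  then show ?thesis
    using palindromic_word(2)[where e = "block_sign p L" and r = "h - 1", OF h pal]
      signs_block_sign[of p L] by (simp add: signs_def)
qed

end

lemma sign_change_roots:
  fixes g :: "real \<Rightarrow> real" and y :: "nat \<Rightarrow> real"
  assumes g: "continuous_on UNIV g"
    and y: "\<And>i. i < N \<Longrightarrow> y i < y (Suc i)"
    and sgn: "\<And>i. i \<le> N \<Longrightarrow> (- 1) ^ i * g (y i) > 0"
  shows "\<exists>S. finite S \<and> card S = N \<and> (\<forall>x\<in>S. g x = 0)"
proof -
  have "\<exists>x. y i < x \<and> x < y (Suc i) \<and> g x = 0" if i: "i < N" for i
  proof -
    define h where "h = (\<lambda>x. (- 1) ^ i * g x)"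
    have "h (y (Suc i)) \<le> 0" "0 \<le> h (y i)"
      using sgn[of i] sgn[of "Suc i"] i by (simp_all add: h_def)
    moreover have "continuous_on {y i..y (Suc i)} h"
      unfolding h_def by (intro continuous_intros continuous_on_subset[OF g]) auto
    ultimately obtain x where x: "y i \<le> x" "x \<le> y (Suc i)" "h x = 0"
      using IVT2'[of h "y (Suc i)" 0 "y i"] y[OF i] by force
    moreover have "x \<noteq> y i" "x \<noteq> y (Suc i)"
      using x(3) sgn[of i] sgn[of "Suc i"] i by (auto simp: h_def)
    ultimately show ?thesis
      by (intro exI[of _ x]) (auto simp: h_def)
  qed
  then obtain x where x: "\<And>i. i < N \<Longrightarrow> y i < x i \<and> x i < y (Suc i) \<and> g (x i) = 0"
    by metis
  have mono: "y i \<le> y j" if "i \<le> j" "j \<le> N" for i j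
    using that
  proof (induction rule: dec_induct)
    case (step n)
    then show ?case using y[of n] by simp
  qed simp
  have "x i < x j" if "i < j" "j < N" for i j
    using x[of i] x[of j] mono[of "Suc i" j] that by force
  then have "inj_on x {..<N}"
    by (intro linorder_inj_onI) force+
  then show ?thesis
    using x by (intro exI[of _ "x ` {..<N}"]) (auto simp: card_image)
qed

section \<open>Real roots at \<open>x = 2\<close>\<close>

lemma cos_pi_fraction_less:
  assumes "i < j" "j \<le> n"
  shows "cos (pi * real j / real n) < cos (pi * real i / real n)"
proof (intro cos_monotone_0_pi)
  have "pi * real j \<le> pi * real n"
    using assms by (intro mult_left_mono) auto
  then show "pi * real j / real n \<le> pi"
    using assms by (simp add: divide_le_eq)
qed (use assms in \<open>auto simp: divide_strict_right_mono\<close>)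

text \<open>The function \<open>t\<close> may oscillate, so the points are chosen one after another:
  each is sought to the right of its predecessor, where \<open>t\<close> still has to descend to -2
  or below.\<close>

lemma trace_values_chain:
  fixes t :: "real \<Rightarrow> real"
  assumes t: "continuous_on UNIV t" "t 2 = 2" "t 10 \<le> - 2" and n: "m < n"
  shows "\<exists>y. y 0 = 2 \<and> (\<forall>i\<le>m. t (y i) = 2 * cos (pi * real i / real n) \<and> y i < 10) \<and>
    (\<forall>i<m. y i < y (Suc i))"
  using n
proof (induction m)
  case 0
  show ?case using t by (intro exI[of _ "\<lambda>_. 2"]) simp
next
  case (Suc m)
  then obtain y where y: "y 0 = 2" "\<And>i. i \<le> m \<Longrightarrow> t (y i) = 2 * cos (pi * real i / real n)"
    "\<And>i. i \<le> m \<Longrightarrow> y i < 10" "\<And>i. i < m \<Longrightarrow> y i < y (Suc i)"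
    by (metis Suc_lessD)
  define c where "c = 2 * cos (pi * real (Suc m) / real n)"
  have "cos (pi * real (Suc m) / real n) < cos (pi * real m / real n)"
    using Suc.prems by (intro cos_pi_fraction_less) auto
  then have lt: "c < t (y m)"
    using y(2)[of m] by (simp add: c_def)
  have "cos pi < cos (pi * real (Suc m) / real n)"
    using cos_pi_fraction_less[of "Suc m" n n] Suc.prems by simp
  then have gt: "t 10 < c"
    using t(3) by (simp add: c_def)
  obtain x where x: "y m \<le> x" "x \<le> 10" "t x = c"
    using IVT2'[of t 10 c "y m"] lt gt y(3)[of m] continuous_on_subset[OF t(1)] by force
  have "x \<noteq> y m" "x \<noteq> 10"
    using x lt gt by auto
  with x have "y m < x" "x < 10" by auto
  then show ?case
    using y x(3) by (intro exI[of _ "y(Suc m := x)"]) (auto simp: c_def le_Suc_eq less_Suc_eq)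
qed

lemma elliptic_angle:
  assumes "0 < i" "i < n"
  shows "sin (pi * real i / real n) \<noteq> 0" "real n * (pi * real i / real n) = pi * real i"
proof -
  have "0 < pi * real i / real n" "pi * real i / real n < pi"
    using assms by (auto simp: field_simps)
  then show "sin (pi * real i / real n) \<noteq> 0"
    using sin_gt_zero by force
  show "real n * (pi * real i / real n) = pi * real i"
    using assms by simp
qed

text \<open>
  \<open>box_sign c K L\<close> is constant up to \<open>(-1)\<^sup>(\<^sup>L\<^sup>+\<^sup>1\<^sup>)\<^sup>j\<close> on blocks of length \<open>K\<close>, the first of which starts at \<open>c\<close>.
\<close>

definition box_sign :: "nat \<Rightarrow> nat \<Rightarrow> nat \<Rightarrow> nat \<Rightarrow> int" where
  "box_sign c K L j = (- 1) ^ ((L + 1) * j + (j - c) div K)"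

lemma signs_box_sign: "signs (box_sign c K L)"
  by (simp add: signs_def box_sign_def minus_one_power_iff)

text \<open>Shifting \<open>j\<close> by the odd number \<open>K\<close> changes both summands of
  the exponent in \<open>box_sign\<close> by odd numbers, so the signs have period \<open>K\<close>
  and the letters period \<open>2 * K\<close>. The word is therefore the \<open>n\<close>-th power
  of its first \<open>2 * K\<close> letters, whose trace runs from 2 to at most -2.\<close>

lemma box_word_points_odd_even:
  fixes K n c :: nat
  assumes K: "odd K" and n: "n > 0" and c: "c \<le> 1"
  defines "g \<equiv> \<lambda>y. m11 (word 1 1 (2 - y :: real) (box_sign c K (2 * n)) [c..<c + K * (2 * n)])"
  shows "\<exists>y. y 0 = 2 \<and> (\<forall>i<n. y i < 10 \<and> g (y i) = (- 1) ^ i) \<and> (\<forall>i. Suc i < n \<longrightarrow> y i < y (Suc i))"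
proof -
  define e where "e = box_sign c K (2 * n)"
  note e = signs_box_sign[of c K "2 * n", folded e_def]
  have K0: "K > 0" using K by (cases K) auto
  have per1: "e (j + K) = e j" if "c \<le> j" for j
  proof -
    have shift: "j + K - c = (j - c) + K"
      using that by simp
    have "(j + K - c) div K = Suc ((j - c) div K)"
      unfolding shift using K0 by simp
    then show ?thesis
      using K by (simp add: e_def box_sign_def minus_one_power_iff)
  qed
  have per: "letter s t u e (j + 2 * K) = letter s t u e j" if "c \<le> j" for j and s t u :: real
    using per1[of j] per1[of "j + K"] that by (simp add: letter_def mult_2 add.assoc)
  define M where "M = (\<lambda>y::real. word 1 1 (2 - y) e [c..<c + 2 * K])"
  define t where "t = (\<lambda>y. m11 (M y) + m22 (M y))"
  have g: "g y = m11 (M y ^ n)" for y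
    using prod_list_upt_periodic[of c "letter 1 1 (2 - y) e" "2 * K" n, OF per]
    by (simp add: g_def M_def word_def e_def mult.left_commute mult.assoc)
  have t_cont: "continuous_on UNIV t"
    unfolding t_def M_def by (intro continuous_intros continuous_on_word[OF e])
  have t2: "t 2 = 2"
    using word_zero[OF e] by (simp add: t_def M_def)
  \<comment> \<open>Cyclic invariance of the trace moves the start of the period to an odd index, as
    \<open>hyperbolic_word_trace\<close> demands.\<close>
  have rotate: "t y = m11 (word 1 1 (2 - y) e [1..<1 + 2 * K]) + m22 (word 1 1 (2 - y) e [1..<1 + 2 * K])" for y
  proof (cases "c = 0")
    case True
    have "[0..<2 * K] = 0 # [1..<2 * K]" "[1..<1 + 2 * K] = [1..<2 * K] @ [2 * K]"
      using K0 by (simp_all add: upt_conv_Cons)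
    moreover have "letter 1 1 (2 - y) e (2 * K) = letter 1 1 (2 - y) e 0"
      using per[of 0] True by simp
    ultimately show ?thesis
      using True by (simp add: t_def M_def algebra_simps)
  next
    case False
    then have "c = 1" using c by simp
    then show ?thesis by (simp add: t_def M_def)
  qed
  have "prod_list (map e [1..<1 + 2 * K]) = prod_list (map e [1..<1 + K]) ^ 2"
    using prod_list_upt_periodic[of 1 e K 2] per1 c by (simp add: mult.commute)
  also have "\<dots> = 1"
  proof -
    have "prod_list (map e js) = 1 \<or> prod_list (map e js) = - 1" for js
      using e by (induction js) (auto simp: signs_def)
    then show ?thesis by (metis power2_minus power_one)
  qed
  finally have "(- 1) ^ K * prod_list (map e [1..<1 + 2 * K]) = - 1"
    using K by simp
  then have t10: "t 10 \<le> - 2"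
    using hyperbolic_word_trace[OF e _ K0, of 1] by (simp add: rotate)
  from trace_values_chain[OF t_cont t2 t10, of "n - 1" n] n
  obtain y where y: "y 0 = 2" "\<And>i. i < n \<Longrightarrow> t (y i) = 2 * cos (pi * real i / real n)"
    "\<And>i. i < n \<Longrightarrow> y i < 10" "\<And>i. Suc i < n \<Longrightarrow> y i < y (Suc i)"
    by (auto simp: less_eq_Suc_le[symmetric] le_diff_conv less_diff_conv simp flip: less_Suc_eq_le)
  have "g (y i) = (- 1) ^ i" if i: "i < n" for i
  proof (cases "i = 0")
    case True
    then show ?thesis
      using word_zero[OF e] y(1) by (simp add: g_def e_def)
  next
    case False
    have "M (y i) ^ n = Mat2 ((- 1) ^ i) 0 0 ((- 1) ^ i)"
      using False i y(2)[OF i] elliptic_angle[of i n] word_det[OF e]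
      by (intro elliptic_power[of _ "pi * real i / real n"]) (simp_all add: M_def t_def)
    then show ?thesis by (simp add: g)
  qed
  with y show ?thesis by blast
qed

text \<open>Now \<open>(L + 1) * j\<close> is even, so the sign is constant on each block of
  \<open>2 * n\<close> letters. A block is the \<open>n\<close>-th power of a two-letter word, and
  all blocks become the same scalar (-1)^i at once; their number \<open>L\<close> is odd.\<close>

lemma box_word_points_even_odd:
  fixes L n c :: nat
  assumes L: "odd L" and n: "n > 0"
  defines "g \<equiv> \<lambda>y. m11 (word 1 1 (2 - y :: real) (box_sign c (2 * n) L) [c..<c + 2 * n * L])"
  shows "\<exists>y. y 0 = 2 \<and> (\<forall>i<n. y i < 10 \<and> g (y i) = (- 1) ^ i) \<and> (\<forall>i. Suc i < n \<longrightarrow> y i < y (Suc i))"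
proof -
  define e where "e = box_sign c (2 * n) L"
  note e = signs_box_sign[of c "2 * n" L, folded e_def]
  \<comment> \<open>A two-letter word with equal signs has trace \<open>2 + u = 4 - y\<close>, so
    the elliptic points are explicit.\<close>
  define y where "y = (\<lambda>i. 4 - 2 * cos (pi * real i / real n))"
  have "g (y i) = (- 1) ^ i" if i: "i < n" for i
  proof (cases "i = 0")
    case True
    then show ?thesis
      using word_zero[OF e] by (simp add: g_def e_def y_def)
  next
    case False
    define S where "S = Mat2 ((- 1) ^ i) 0 0 ((- 1) ^ i :: real)"
    have block: "word 1 1 (2 - y i) e [d..<d + 2 * n] = S" if d: "d = c + 2 * n * b" for b d
    proof -
      define e' where "e' = (\<lambda>j::nat. (- 1) ^ b :: int)"
      have e': "signs e'"
        by (simp add: signs_def e'_def minus_one_power_iff)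
      have "word 1 1 (2 - y i) e [d..<d + 2 * n] = word 1 1 (2 - y i) e' [d..<d + 2 * n]"
      proof (rule word_cong)
        fix j assume "j \<in> set [d..<d + 2 * n]"
        then obtain r where r: "j = d + r" "r < 2 * n"
          using le_Suc_ex by fastforce
        have "(j - c) div (2 * n) = b"
          using r n by (simp add: d)
        then show "e j = e' j"
          using L by (simp add: e_def e'_def box_sign_def power_add power_mult)
      qed
      also have "\<dots> = word 1 1 (2 - y i) e' [d..<d + 2] ^ n"
        unfolding word_def by (rule prod_list_upt_periodic) (simp add: letter_def e'_def)
      also have "\<dots> = S"
        unfolding S_def
      proof (rule elliptic_power)
        let ?M = "word 1 1 (2 - y i) e' [d..<d + 2]"
        show "m11 ?M * m22 ?M - m12 ?M * m21 ?M = 1"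
          by (rule word_det[OF e'])
        have "[d..<d + 2] = [d, Suc d]"
          by (simp add: upt_rec)
        then show "m11 ?M + m22 ?M = 2 * cos (pi * real i / real n)"
          by (simp add: letter_parabolic[OF e'] y_def) (simp add: e'_def minus_one_power_iff)
      qed (use n False i elliptic_angle[of i n] in auto)
      finally show ?thesis .
    qed
    have "word 1 1 (2 - y i) e [c..<c + 2 * n * L] = prod_list (map (\<lambda>b.
        word 1 1 (2 - y i) e [c + 2 * n * b..<c + 2 * n * b + 2 * n]) [0..<L])"
      unfolding word_def by (rule prod_list_upt_blocks)
    also have "\<dots> = prod_list (map (\<lambda>b. S) [0..<L])"
      by (simp only: block[OF refl])
    also have "prod_list (map (\<lambda>b. S) [0..<m]) = Mat2 ((- 1) ^ (i * m)) 0 0 ((- 1) ^ (i * m))" for m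
      by (induction m) (simp_all add: S_def one_mat2_def times_mat2_def power_add)
    finally show ?thesis
      using L by (simp add: g_def e_def minus_one_power_iff)
  qed
  moreover have "y i < y (Suc i)" if "Suc i < n" for i
  proof -
    have "cos (pi * real (Suc i) / real n) < cos (pi * real i / real n)"
      using that by (intro cos_pi_fraction_less) auto
    then show ?thesis by (simp add: y_def)
  qed
  moreover have "y i < 10" for i
    using cos_ge_minus_one[of "pi * real i / real n"] unfolding y_def by linarith
  moreover have "y 0 = 2" by (simp add: y_def)
  ultimately show ?thesis by blast
qed

lemma box_word_points:
  fixes K L N m c :: nat
  assumes "K > 0" "L > 0" "K * L = 2 * N * m" "2 * N = (if even L then L else K)" "odd m" "c \<le> 1"
  defines "g \<equiv> \<lambda>y. m11 (word 1 1 (2 - y :: real) (box_sign c K L) [c..<c + K * L])"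
  shows "\<exists>y. y 0 = 2 \<and> (\<forall>i<N. y i < 10 \<and> g (y i) = (- 1) ^ i) \<and> (\<forall>i. Suc i < N \<longrightarrow> y i < y (Suc i))"
proof (cases "even L")
  case True
  then have "L = 2 * N" using assms(4) by simp
  moreover from this have "K = m" "N > 0" using assms(2,3) by auto
  ultimately show ?thesis
    using box_word_points_odd_even[of K N c] assms(5,6) by (simp add: g_def)
next
  case False
  then have "K = 2 * N" using assms(4) by simp
  moreover from this have "N > 0" using assms(1) by auto
  ultimately show ?thesis
    using box_word_points_even_odd[of L N c] False by (simp add: g_def)
qed

section \<open>Double twist knots at \<open>x = 2\<close>\<close>

context
  fixes k l :: int and K L :: nat
  assumes nz: "k \<noteq> 0" "l \<noteq> 0" and even: "even (k * l)"
  defines "K \<equiv> nat \<bar>k\<bar>" and "L \<equiv> nat \<bar>l\<bar>"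
begin

abbreviation \<Phi> where "\<Phi> y \<equiv> poly_xy (double_twist_riley_poly k l) 2 (complex_of_real y)"

lemma KL: "K > 0" "L > 0" "even (K * L)" "\<bar>k * l\<bar> = int (K * L)"
  using nz even by (auto simp: K_def L_def even_nat_iff abs_mult)

lemma double_twist_riley_poly_pos:
  assumes "k * l > 0"
  defines "p \<equiv> K * L - 1"
  shows "\<Phi> y = complex_of_real (m11 (word 1 1 (2 - y) (box_sign 0 K L) [1..<p]))"
    and "prod_list (map (box_sign 0 K L) [1..<p]) = 1" and "odd p"
proof -
  have KL2: "K * L \<ge> 2"
    using KL by (cases "K * L") (auto elim!: oddE evenE)
  have klp: "k * l - 1 = int p"
    using KL(4) KL2 assms(1) unfolding p_def by linarith
  have "odd p"
    using KL KL2 by (simp add: p_def)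
  moreover have "nat \<bar>k * l - 1\<bar> = p"
    unfolding klp by simp
  ultimately have p: "odd p" "nat \<bar>k * l - 1\<bar> = p"
    by simp_all
  have "k * l - 1 \<noteq> 0"
    unfolding klp using p(1) by (cases p) simp_all
  then have q: "\<bar>- sgn (k * l - 1) * l\<bar> = int L"
    by (simp add: abs_mult abs_sgn_eq L_def)
  have ndvd: "\<not> p dvd j * L" if "0 < j" "j < p" for j
    using not_dvd_mult_minus_one[of K L j] KL that by (simp add: p_def)
  have sign: "block_sign p L j = box_sign 0 K L j" if "j \<in> set [1..<p]" for j
    using div_mult_minus_one[of K L j] KL that by (simp add: block_sign_def box_sign_def p_def)
  have "\<Phi> y = complex_of_real (m11 (word 1 1 (2 - y) (block_sign p L) [1..<p]))"
    using riley_poly_2[OF p(1) q ndvd] by (simp add: double_twist_riley_poly_def p(2))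
  also have "word 1 1 (2 - y) (block_sign p L) [1..<p] = word 1 1 (2 - y) (box_sign 0 K L) [1..<p]"
    by (rule word_cong) (rule sign)
  finally show "\<Phi> y = complex_of_real (m11 (word 1 1 (2 - y) (box_sign 0 K L) [1..<p]))" .
  have "map (block_sign p L) [1..<p] = map (box_sign 0 K L) [1..<p]"
    by (rule map_cong[OF refl]) (rule sign)
  then show "prod_list (map (box_sign 0 K L) [1..<p]) = 1"
    using block_sign_prod[OF p(1) q ndvd] by (simp only:)
  show "odd p" by (rule p(1))
qed

lemma double_twist_riley_poly_neg:
  assumes "k * l < 0"
  defines "p \<equiv> K * L + 1"
  shows "\<Phi> y = complex_of_real (m11 (word 1 1 (2 - y) (box_sign 1 K L) [1..<p]))"
    and "prod_list (map (box_sign 1 K L) [1..<p]) = 1"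
proof -
  have klp: "k * l - 1 = - int p"
    using KL(4) assms(1) by (simp add: p_def)
  have "odd p"
    using KL by (simp add: p_def)
  moreover have "nat \<bar>k * l - 1\<bar> = p"
    unfolding klp by simp
  ultimately have p: "odd p" "nat \<bar>k * l - 1\<bar> = p"
    by simp_all
  have "k * l - 1 \<noteq> 0"
    unfolding klp using p(1) by (cases p) simp_all
  then have q: "\<bar>- sgn (k * l - 1) * l\<bar> = int L"
    by (simp add: abs_mult abs_sgn_eq L_def)
  have ndvd: "\<not> p dvd j * L" if "0 < j" "j < p" for j
    using not_dvd_mult_plus_one[of K L j] KL that by (simp add: p_def)
  have sign: "block_sign p L j = box_sign 1 K L j" if "j \<in> set [1..<p]" for j
  proof -
    have j: "0 < j" "j < K * L + 1"
      using that by (auto simp: p_def)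
    show ?thesis
      unfolding block_sign_def box_sign_def p_def div_mult_plus_one[OF KL(1,2) j] ..
  qed
  have "\<Phi> y = complex_of_real (m11 (word 1 1 (2 - y) (block_sign p L) [1..<p]))"
    using riley_poly_2[OF p(1) q ndvd] by (simp add: double_twist_riley_poly_def p(2))
  also have "word 1 1 (2 - y) (block_sign p L) [1..<p] = word 1 1 (2 - y) (box_sign 1 K L) [1..<p]"
    by (rule word_cong) (rule sign)
  finally show "\<Phi> y = complex_of_real (m11 (word 1 1 (2 - y) (box_sign 1 K L) [1..<p]))" .
  have "map (block_sign p L) [1..<p] = map (box_sign 1 K L) [1..<p]"
    by (rule map_cong[OF refl]) (rule sign)
  then show "prod_list (map (box_sign 1 K L) [1..<p]) = 1"
    using block_sign_prod[OF p(1) q ndvd] by (simp only:)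
qed

lemma real_roots_even_pos:
  assumes "even k" "even l" "k * l > 0"
  shows "\<exists>S. finite S \<and> card S = 1 \<and> (\<forall>y\<in>S. \<Phi> y = 0)"
proof -
  define e where "e = box_sign 0 K L"
  note e = signs_box_sign[of 0 K L, folded e_def]
  define g where "g = (\<lambda>y::real. m11 (word 1 1 (2 - y) e [1..<K * L - 1]))"
  have "even K" "even L"
    using assms(1,2) by (simp_all add: K_def L_def even_nat_iff)
  then obtain a b where KLab: "K = 2 * a" "L = 2 * b"
    by (elim evenE)
  then have ab: "K = 2 * a" "L = 2 * b" "a > 0" "b > 0"
    using KL(1,2) by auto
  define r where "r = 2 * a * b - 1"
  have "a * b > 0" using ab by simp
  then obtain c where c: "a * b = Suc c"
    using gr0_implies_Suc by blast
  have "r = 2 * c + 1" "K * L = 4 * c + 4"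
    by (simp_all add: r_def ab c mult.assoc mult.left_commute[of a])
  then have r: "odd r" "1 + 2 * r = K * L - 1"
    by simp_all
  have "(- 1) ^ r * real_of_int (prod_list (map e [1..<1 + 2 * r])) = - 1"
    using double_twist_riley_poly_pos(2)[OF assms(3)] r by (simp add: e_def)
  with hyperbolic_word_rows(2)[OF e, of 1 r] have "5 ^ r \<le> - g 10"
    by (simp only: r(2) g_def) simp
  moreover have "(5::real) ^ r > 0" by simp
  ultimately have "g 10 < 0" by linarith
  moreover have "g 2 = 1"
    using word_zero[OF e] by (simp add: g_def)
  ultimately have "\<exists>S. finite S \<and> card S = 1 \<and> (\<forall>x\<in>S. g x = 0)"
    using continuous_on_word(1)[OF e]
    by (intro sign_change_roots[of g 1 "\<lambda>i. if i = 0 then 2 else 10"]) (auto simp: g_def le_Suc_eq)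
  then show ?thesis
    using double_twist_riley_poly_pos(1)[OF assms(3)] by (auto simp: g_def e_def)
qed

context
  fixes N m :: nat
  assumes mixed: "K * L = 2 * N * m" "2 * N = (if even L then L else K)" "odd m"
begin

lemma real_roots_mixed_pos:
  assumes "k * l > 0"
  shows "\<exists>S. finite S \<and> card S = N - 1 \<and> (\<forall>y\<in>S. \<Phi> y = 0)"
proof -
  define e where "e = box_sign 0 K L"
  note e = signs_box_sign[of 0 K L, folded e_def]
  define g where "g = (\<lambda>y::real. m11 (word 1 1 (2 - y) e [0..<K * L]))"
  have N: "N > 0"
    using mixed KL by (cases N) auto
  have KL2: "K * L \<ge> 2"
    using KL by (cases "K * L") (auto elim!: oddE evenE)
  \<comment> \<open>The letter at index 0 is lower triangular and acts from the left, the one at the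
    odd index \<open>K * L - 1\<close> is upper triangular and acts from the right. Both have unit
    diagonal, so \<open>m11\<close> does not change.\<close>
  have "[0..<K * L] = 0 # [1..<K * L - 1] @ [K * L - 1]"
  proof -
    obtain d where d: "K * L = Suc (Suc d)"
      using KL2 by (metis add_2_eq_Suc le_Suc_ex)
    have "[0..<Suc (Suc d)] = [0..<Suc d] @ [Suc d]"
      by (rule upt_Suc_append) simp
    also have "[0..<Suc d] = 0 # [Suc 0..<Suc d]"
      by (rule upt_conv_Cons) simp
    finally show ?thesis
      unfolding d by (simp del: upt_Suc)
  qed
  then have pad: "g y = m11 (word 1 1 (2 - y) e [1..<K * L - 1])" for y
    using double_twist_riley_poly_pos(3)[OF assms] by (simp add: g_def letter_parabolic[OF e])
  from box_word_points[OF KL(1,2) mixed, of 0] obtain y where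
    y: "\<And>i. i < N \<Longrightarrow> g (y i) = (- 1) ^ i" "\<And>i. Suc i < N \<Longrightarrow> y i < y (Suc i)"
    by (auto simp: g_def e_def)
  have "\<exists>S. finite S \<and> card S = N - 1 \<and> (\<forall>x\<in>S. g x = 0)"
  proof (rule sign_change_roots)
    show "continuous_on UNIV g"
      unfolding g_def by (rule continuous_on_word(1)[OF e])
    show "y i < y (Suc i)" if "i < N - 1" for i
      using y(2) that by simp
    show "(- 1) ^ i * g (y i) > 0" if "i \<le> N - 1" for i
      using y(1)[of i] that N by (simp flip: power_mult_distrib)
  qed
  then show ?thesis
    using double_twist_riley_poly_pos(1)[OF assms] by (auto simp: pad e_def)
qed

lemma real_roots_mixed_neg:
  assumes "k * l < 0"
  shows "\<exists>S. finite S \<and> card S = N \<and> (\<forall>y\<in>S. \<Phi> y = 0)"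
proof -
  define e where "e = box_sign 1 K L"
  note e = signs_box_sign[of 1 K L, folded e_def]
  define g where "g = (\<lambda>y::real. m11 (word 1 1 (2 - y) e [1..<K * L + 1]))"
  from box_word_points[OF KL(1,2) mixed, of 1] obtain y where
    y: "\<And>i. i < N \<Longrightarrow> y i < 10 \<and> g (y i) = (- 1) ^ i" "\<And>i. Suc i < N \<Longrightarrow> y i < y (Suc i)"
    by (auto simp: g_def e_def add.commute)
  define r where "r = N * m"
  have r: "1 + 2 * r = K * L + 1"
    using mixed by (simp add: r_def)
  \<comment> \<open>The word has \<open>2 * r\<close> letters with \<open>r = N * m\<close>, and
    \<open>m\<close> is odd; so the sign at \<open>y = 10\<close> is the one that should follow the
    \<open>N\<close> alternating values.\<close>
  have "(- 1) ^ r * real_of_int (prod_list (map e [1..<1 + 2 * r])) = (- 1) ^ N"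
    using double_twist_riley_poly_neg(2)[OF assms] mixed(3) unfolding r
    by (simp add: e_def r_def minus_one_power_iff)
  with hyperbolic_word_rows(2)[OF e, of 1 r] have "5 ^ r \<le> (- 1) ^ N * g 10"
    by (simp only: r g_def) simp
  moreover have "(5::real) ^ r > 0" by simp
  ultimately have g10: "(- 1) ^ N * g 10 > 0" by linarith
  have "\<exists>S. finite S \<and> card S = N \<and> (\<forall>x\<in>S. g x = 0)"
  proof (rule sign_change_roots)
    show "continuous_on UNIV g"
      unfolding g_def by (rule continuous_on_word(1)[OF e])
    show "(y(N := 10)) i < (y(N := 10)) (Suc i)" if "i < N" for i
      using y that by (cases "Suc i = N") auto
    show "(- 1) ^ i * g ((y(N := 10)) i) > 0" if "i \<le> N" for i
      using y(1)[of i] that g10 by (cases "i = N") (auto simp flip: power_mult_distrib)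
  qed
  then show ?thesis
    using double_twist_riley_poly_neg(1)[OF assms] by (auto simp: g_def e_def)
qed

end

end

theorem corollary1:
  fixes k l :: int
    and out :: "(nat + nat) \<times> compass \<Rightarrow> bool"
    and V :: "int mat"
    and \<sigma> :: int
  assumes "k \<noteq> 0" and "l \<noteq> 0" and "even (k * l)"
    and "orientation (double_twist k l) out"
    and "seifert_matrix (double_twist k l) out V"
    and "\<sigma> = matrix_signature (map_mat real_of_int (V + transpose_mat V))"
  shows "\<exists>S :: real set. finite S \<and>
    (\<forall>y\<in>S. poly_xy (double_twist_riley_poly k l) 2 (complex_of_real y) = 0) \<and>
    1 / 2 * real_of_int \<bar>\<sigma>\<bar> \<le> real (card S)"
proof -
  define K L where "K = nat \<bar>k\<bar>" and "L = nat \<bar>l\<bar>"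
  let ?\<Phi> = "\<lambda>y. poly_xy (double_twist_riley_poly k l) 2 (complex_of_real y)"
  interpret oriented_double_twist k l out K L
    using assms(1,2,4) by unfold_locales (simp_all add: K_def L_def)
  have kl: "k * l < 0 \<or> 0 < k * l"
    using assms(1,2) by (simp add: linorder_neq_iff[symmetric])
  have suffices: ?thesis if "\<exists>S. finite S \<and> card S = r \<and> (\<forall>y\<in>S. ?\<Phi> y = 0)" "\<bar>\<sigma>\<bar> \<le> 2 * int r" for r
  proof -
    from that(1) obtain S where S: "finite S" "card S = r" "\<forall>y\<in>S. ?\<Phi> y = 0"
      by blast
    have "real_of_int \<bar>\<sigma>\<bar> \<le> real_of_int (2 * int r)"
      using that(2) by (simp only: of_int_le_iff)
    then show ?thesis
      using S by (intro exI[of _ S]) simp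
  qed
  show ?thesis
  proof (cases "even k \<and> even l")
    case True
    then show ?thesis
      using kl
    proof (elim disjE)
      assume "k * l < 0"
      then show ?thesis
        using signature_both_even(2)[OF _ _ assms(5)] True assms(6)
        by (intro suffices[of 0]) auto
    next
      assume "0 < k * l"
      then show ?thesis
        using signature_both_even(1)[OF _ _ assms(5)] True assms(6)
          real_roots_even_pos[OF assms(1-3)]
        by (intro suffices[of 1]) auto
    qed
  next
    case False
    \<comment> \<open>\<open>N\<close> is half of the even crossing number and \<open>m\<close> is
      the odd one, which treats the two mixed parity cases together.\<close>
    have "\<exists>N m. K * L = 2 * N * m \<and> 2 * N = (if even L then L else K) \<and> odd m \<and>
        \<bar>\<sigma>\<bar> \<le> 2 * int N \<and> (0 < k * l \<longrightarrow> \<bar>\<sigma>\<bar> \<le> 2 * int N - 2)"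
    proof (cases "even l")
      case True
      then have "odd k" using False by simp
      then show ?thesis
        using True signature_odd_even[OF _ _ assms(5)] assms(6) parity
        by (intro exI[of _ "L div 2"] exI[of _ K]) (auto simp: mult.commute)
    next
      case l: False
      then have "even k" using assms(3) by simp
      then show ?thesis
        using l signature_even_odd[OF _ _ assms(5)] assms(6) parity
        by (intro exI[of _ "K div 2"] exI[of _ L]) auto
    qed
    then obtain N m where mixed: "K * L = 2 * N * m" "2 * N = (if even L then L else K)" "odd m"
      and bounds: "\<bar>\<sigma>\<bar> \<le> 2 * int N" "0 < k * l \<Longrightarrow> \<bar>\<sigma>\<bar> \<le> 2 * int N - 2"
      by blast
    note mixed' = mixed[unfolded K_def L_def]
    from kl show ?thesis
    proof
      assume "k * l < 0"
      then show ?thesis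
        using real_roots_mixed_neg[OF assms(1-3) mixed'] bounds(1) by (intro suffices[of N]) auto
    next
      assume pos: "0 < k * l"
      have "N > 0"
        using mixed(1) mn by (cases N) auto
      then show ?thesis
        using real_roots_mixed_pos[OF assms(1-3) mixed' pos] bounds(2)[OF pos]
        by (intro suffices[of "N - 1"]) auto
    qed
  qed
qed

end
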